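(* Let $p\ne 2$ be a prime, let $n$ be a positive integer, and let $\xi\in\mathbb{Z}_p$ be an $n$th root of unity. Then for every integer $e\ge 1$, $$|G_{\xi,e}|=\frac{p-1}{\mathrm{ord}_p(\xi)}\,N_{x^n-1}(\mathrm{ord}_p(\xi))\cdot\begin{cases}p^{e-1}&\text{if } e\le v_p(n),\\ p^{\lfloor (e+v_p(n))/2\rfloor}&\text{if } e\ge v_p(n)+1,\end{cases}$$ and $$|G_{\xi,\infty}|=\frac{p-1}{\mathrm{ord}_p(\xi)}\,N_{x^n-1}(\mathrm{ord}_p(\xi)).$$
   Context: Here $p$ is an odd prime. $\mathbb{Z}_p$ is the ring of $p$-adic integers and $v_p$ the $p$-adic valuation. For $x\in\mathbb{Z}_p^\times$, $\omega(x)$ is the Teichmüller representative of $x$ (the unique $(p-1)$-th root of unity in $\mathbb{Z}_p$ congruent to $x$ modulo $p$), and $\langle x\rangle=x/\omega(x)\in 1+p\mathbb{Z}_p$; for $z\in\mathbb{Z}_p$, $\langle x\rangle^{z}=\exp(z\log\langle x\rangle)$. For $\xi\in\mathbb{Z}_p^\times$, $\mathrm{ord}_p(\xi)$ is the multiplicative order of $\xi$ modulo $p$. For a positive integer $d$, $N_{x^n-1}(d)$ is the number of $z\in\mathbb{Z}/d\mathbb{Z}$ with $z^n-1\equiv 0\pmod d$. For $a\in\mathbb{Z}_p$ and $e\ge1$, $G_{a,e}$ is the set of integers $x$ with $1\le x\le p^e(p-1)$, $p\nmid x$, $x\equiv a\pmod p$ and $x^{x^n}\equiv x\pmod{p^e}$.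 $G_{a,\infty}$ is the set of pairs $(x,x_0)\in\mathbb{Z}_p\times\{1,\dots,p-1\}$ with $p\nmid x$, $x\equiv a\pmod p$ and $\omega(x)^{x_0^n}\langle x\rangle^{x^n}=x$. *)

theory Defs
  imports Complex_Main "HOL-Algebra.Divisibility" "HOL-Number_Theory.Number_Theory"
begin

hide_const (open) Divisibility.prime

text \<open>
  The ring of \<open>p\<close>-adic integers is the inverse limit of the rings \<open>\<int>/p\<^sup>k\<int>\<close>. An element is its
  sequence of residues: \<open>x k\<close> is the representative in \<open>{0..<p\<^sup>k}\<close> of \<open>x\<close> modulo \<open>p\<^sup>k\<close>.
\<close>

definition Zp :: "nat \<Rightarrow> (nat \<Rightarrow> int) ring" where
  "Zp p =
    \<lparr>carrier = {x. \<forall>k. 0 \<le> x k \<and> x k < int p ^ k \<and> x (Suc k) mod int p ^ k = x k},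
     monoid.mult = (\<lambda>x y k. (x k * y k) mod int p ^ k),
     one = (\<lambda>k. 1 mod int p ^ k),
     zero = (\<lambda>k. 0),
     add = (\<lambda>x y k. (x k + y k) mod int p ^ k)\<rparr>"

definition padic_of_int :: "nat \<Rightarrow> int \<Rightarrow> (nat \<Rightarrow> int)" where
  "padic_of_int p m = [m] \<cdot>\<^bsub>Zp p\<^esub> \<one>\<^bsub>Zp p\<^esub>"

text \<open>\<open>x \<equiv> y\<close> modulo \<open>p\<^sup>m \<int>\<^sub>p\<close>.\<close>

definition padic_cong :: "nat \<Rightarrow> nat \<Rightarrow> (nat \<Rightarrow> int) \<Rightarrow> (nat \<Rightarrow> int) \<Rightarrow> bool" where
  "padic_cong p m x y \<longleftrightarrow> padic_of_int p (int p ^ m) divides\<^bsub>Zp p\<^esub> (x \<ominus>\<^bsub>Zp p\<^esub> y)"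

definition teichmuller :: "nat \<Rightarrow> (nat \<Rightarrow> int) \<Rightarrow> (nat \<Rightarrow> int)" where
  "teichmuller p x =
    (THE t. t \<in> carrier (Zp p) \<and> t [^]\<^bsub>Zp p\<^esub> (p - 1) = \<one>\<^bsub>Zp p\<^esub> \<and> padic_cong p 1 t x)"

definition padic_angle :: "nat \<Rightarrow> (nat \<Rightarrow> int) \<Rightarrow> (nat \<Rightarrow> int)" where
  "padic_angle p x = x \<otimes>\<^bsub>Zp p\<^esub> inv\<^bsub>Zp p\<^esub> (teichmuller p x)"

text \<open>
  Convergence in the \<open>p\<close>-adic topology. For \<open>p\<close> odd, the exponential is used on \<open>p\<int>\<^sub>p\<close> and the
  logarithm on \<open>1 + p\<int>\<^sub>p\<close>. There every term \<open>y\<^sup>k / k!\<close> and \<open>(x - 1)\<^sup>k / k\<close> of the power series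
  is itself in \<open>\<int>\<^sub>p\<close>, so the quotients are taken in the domain \<open>\<int>\<^sub>p\<close>.
\<close>

definition padic_sums :: "nat \<Rightarrow> (nat \<Rightarrow> (nat \<Rightarrow> int)) \<Rightarrow> (nat \<Rightarrow> int) \<Rightarrow> bool" where
  "padic_sums p f s \<longleftrightarrow> s \<in> carrier (Zp p) \<and>
    (\<forall>m. \<forall>\<^sub>F N in sequentially. padic_cong p m (finsum (Zp p) f {..<N}) s)"

definition padic_suminf :: "nat \<Rightarrow> (nat \<Rightarrow> (nat \<Rightarrow> int)) \<Rightarrow> (nat \<Rightarrow> int)" where
  "padic_suminf p f = (THE s. padic_sums p f s)"

definition padic_div_nat :: "nat \<Rightarrow> (nat \<Rightarrow> int) \<Rightarrow> nat \<Rightarrow> (nat \<Rightarrow> int)" where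
  "padic_div_nat p x m =
    (THE y. y \<in> carrier (Zp p) \<and> padic_of_int p (int m) \<otimes>\<^bsub>Zp p\<^esub> y = x)"

definition padic_exp :: "nat \<Rightarrow> (nat \<Rightarrow> int) \<Rightarrow> (nat \<Rightarrow> int)" where
  "padic_exp p y = padic_suminf p (\<lambda>k. padic_div_nat p (y [^]\<^bsub>Zp p\<^esub> k) (fact k))"

text \<open>\<open>\<Sum>k\<ge>1. (-1)\<^sup>k\<^sup>-\<^sup>1 (x - 1)\<^sup>k / k\<close>, with the index shifted by one.\<close>

definition padic_log :: "nat \<Rightarrow> (nat \<Rightarrow> int) \<Rightarrow> (nat \<Rightarrow> int)" where
  "padic_log p x = padic_suminf p (\<lambda>k.
     (\<ominus>\<^bsub>Zp p\<^esub> \<one>\<^bsub>Zp p\<^esub>) [^]\<^bsub>Zp p\<^esub> k \<otimes>\<^bsub>Zp p\<^esub>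
     padic_div_nat p ((x \<ominus>\<^bsub>Zp p\<^esub> \<one>\<^bsub>Zp p\<^esub>) [^]\<^bsub>Zp p\<^esub> Suc k) (Suc k))"

definition angle_pow :: "nat \<Rightarrow> (nat \<Rightarrow> int) \<Rightarrow> (nat \<Rightarrow> int) \<Rightarrow> (nat \<Rightarrow> int)" where
  "angle_pow p x z = padic_exp p (z \<otimes>\<^bsub>Zp p\<^esub> padic_log p (padic_angle p x))"

text \<open>The multiplicative order modulo \<open>p\<close>; \<open>x 1\<close> is the residue of \<open>x\<close> modulo \<open>p\<close>.\<close>

definition padic_ord :: "nat \<Rightarrow> (nat \<Rightarrow> int) \<Rightarrow> nat" where
  "padic_ord p x = ord p (nat (x 1))"

definition num_unity_roots :: "nat \<Rightarrow> nat \<Rightarrow> nat" where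
  "num_unity_roots n d = card {z :: int. 0 \<le> z \<and> z < int d \<and> [z ^ n - 1 = 0] (mod int d)}"

definition G_fin :: "nat \<Rightarrow> nat \<Rightarrow> (nat \<Rightarrow> int) \<Rightarrow> nat \<Rightarrow> nat set" where
  "G_fin p n a e =
    {x. 1 \<le> x \<and> x \<le> p ^ e * (p - 1) \<and> \<not> p dvd x \<and>
        padic_cong p 1 (padic_of_int p (int x)) a \<and> [x ^ (x ^ n) = x] (mod p ^ e)}"

definition G_inf :: "nat \<Rightarrow> nat \<Rightarrow> (nat \<Rightarrow> int) \<Rightarrow> ((nat \<Rightarrow> int) \<times> nat) set" where
  "G_inf p n a =
    {(x, x0). x \<in> carrier (Zp p) \<and> x0 \<in> {1..p - 1} \<and>
        \<not> padic_of_int p (int p) divides\<^bsub>Zp p\<^esub> x \<and> padic_cong p 1 x a \<and>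
        teichmuller p x [^]\<^bsub>Zp p\<^esub> (x0 ^ n) \<otimes>\<^bsub>Zp p\<^esub> angle_pow p x (x [^]\<^bsub>Zp p\<^esub> n) = x}"

lemma Zp_simps:
  "x \<in> carrier (Zp p) \<longleftrightarrow> (\<forall>k. 0 \<le> x k \<and> x k < int p ^ k \<and> x (Suc k) mod int p ^ k = x k)"
  "x \<otimes>\<^bsub>Zp p\<^esub> y = (\<lambda>k. (x k * y k) mod int p ^ k)"
  "x \<oplus>\<^bsub>Zp p\<^esub> y = (\<lambda>k. (x k + y k) mod int p ^ k)"
  "\<one>\<^bsub>Zp p\<^esub> = (\<lambda>k. 1 mod int p ^ k)"
  "\<zero>\<^bsub>Zp p\<^esub> = (\<lambda>k. 0)"
  by (simp_all add: Zp_def)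

lemma Zp_closed_aux:
  assumes "p > 0" "\<And>k. [f (Suc k) = f k] (mod int p ^ k)"
  shows "(\<lambda>k. f k mod int p ^ k) \<in> carrier (Zp p)"
  using assms by (simp add: Zp_simps cong_def mod_mod_cancel le_imp_power_dvd)

lemma Zp_cong_Suc:
  assumes "x \<in> carrier (Zp p)"
  shows "[x (Suc k) = x k] (mod int p ^ k)"
proof -
  have "x (Suc k) mod int p ^ k = x k" "0 \<le> x k" "x k < int p ^ k"
    using assms by (auto simp: Zp_simps)
  then show ?thesis by (simp add: cong_def)
qed

lemma cring_Zp:
  assumes "p > 0"
  shows "cring (Zp p)"
proof (rule cringI)
  show "abelian_group (Zp p)"
  proof (rule abelian_groupI)
    fix x y assume "x \<in> carrier (Zp p)" "y \<in> carrier (Zp p)"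
    then show "x \<oplus>\<^bsub>Zp p\<^esub> y \<in> carrier (Zp p)"
      unfolding Zp_simps(3) by (intro Zp_closed_aux assms cong_add Zp_cong_Suc)
  next
    fix x assume x: "x \<in> carrier (Zp p)"
    show "\<exists>y\<in>carrier (Zp p). y \<oplus>\<^bsub>Zp p\<^esub> x = \<zero>\<^bsub>Zp p\<^esub>"
    proof (rule bexI)
      show "(\<lambda>k. (- x k) mod int p ^ k) \<in> carrier (Zp p)"
        by (intro Zp_closed_aux assms) (use Zp_cong_Suc[OF x] in \<open>simp add: cong_minus_minus_iff\<close>)
      show "(\<lambda>k. (- x k) mod int p ^ k) \<oplus>\<^bsub>Zp p\<^esub> x = \<zero>\<^bsub>Zp p\<^esub>"
        by (simp add: Zp_simps mod_simps)
    qed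
  qed (use assms in \<open>auto simp: Zp_simps mod_simps algebra_simps fun_eq_iff\<close>)
  show "comm_monoid (Zp p)"
  proof (rule comm_monoidI)
    fix x y assume "x \<in> carrier (Zp p)" "y \<in> carrier (Zp p)"
    then show "x \<otimes>\<^bsub>Zp p\<^esub> y \<in> carrier (Zp p)"
      unfolding Zp_simps(2) by (intro Zp_closed_aux assms cong_mult Zp_cong_Suc)
  next
    show "\<one>\<^bsub>Zp p\<^esub> \<in> carrier (Zp p)"
      unfolding Zp_simps(4) by (rule Zp_closed_aux) (use assms in auto)
  qed (use assms in \<open>auto simp: Zp_simps mod_simps algebra_simps fun_eq_iff\<close>)
qed (use assms in \<open>auto simp: Zp_simps mod_simps algebra_simps fun_eq_iff\<close>)

lemma Zp_minus:
  assumes "p > 0" "x \<in> carrier (Zp p)"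
  shows "\<ominus>\<^bsub>Zp p\<^esub> x = (\<lambda>k. (- x k) mod int p ^ k)"
proof -
  interpret cring "Zp p" by (rule cring_Zp[OF assms(1)])
  have "(\<lambda>k. (- x k) mod int p ^ k) \<in> carrier (Zp p)"
    by (intro Zp_closed_aux assms)
      (use Zp_cong_Suc[OF assms(2)] in \<open>simp add: cong_minus_minus_iff\<close>)
  then show ?thesis
    by (intro minus_equality assms) (simp_all add: Zp_simps mod_simps)
qed

lemma padic_of_int_eq:
  assumes "p > 0"
  shows "padic_of_int p m = (\<lambda>k. m mod int p ^ k)"
proof -
  interpret cring "Zp p" by (rule cring_Zp[OF assms])
  have nat: "[j] \<cdot>\<^bsub>Zp p\<^esub> \<one>\<^bsub>Zp p\<^esub> = (\<lambda>k. int j mod int p ^ k)" for j :: nat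
    by (induction j) (simp_all add: Zp_simps mod_simps add.commute)
  show ?thesis
  proof (cases "m \<ge> 0")
    case True
    then show ?thesis
      by (simp add: padic_of_int_def add_pow_int_ge nat)
  next
    case False
    have "[nat (- m)] \<cdot>\<^bsub>Zp p\<^esub> \<one>\<^bsub>Zp p\<^esub> \<in> carrier (Zp p)" by simp
    from Zp_minus[OF assms this] False show ?thesis
      by (simp add: padic_of_int_def add_pow_int_lt nat mod_simps)
  qed
qed

lemma padic_cong_iff:
  assumes "p > 0" "x \<in> carrier (Zp p)" "y \<in> carrier (Zp p)"
  shows "padic_cong p m x y \<longleftrightarrow> x m = y m"
proof -
  interpret cring "Zp p" by (rule cring_Zp[OF assms(1)])
  define d where "d = x \<ominus>\<^bsub>Zp p\<^esub> y"
  have d: "d \<in> carrier (Zp p)" using assms by (simp add: d_def)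
  have d_eq: "d k = (x k - y k) mod int p ^ k" for k
    by (simp add: d_def a_minus_def Zp_minus[OF assms(1,3)] Zp_simps(3) mod_simps)
  have range: "0 \<le> x m" "x m < int p ^ m" "0 \<le> y m" "y m < int p ^ m"
    using assms by (auto simp: Zp_simps)
  have "x m = y m \<longleftrightarrow> x m mod int p ^ m = y m mod int p ^ m"
    using range by simp
  then have d0: "x m = y m \<longleftrightarrow> d m = 0"
    by (simp add: d_eq mod_eq_dvd_iff mod_eq_0_iff_dvd)
  have "d m = 0 \<longleftrightarrow> (\<exists>c\<in>carrier (Zp p). d = padic_of_int p (int p ^ m) \<otimes>\<^bsub>Zp p\<^esub> c)"
  proof
    assume "\<exists>c\<in>carrier (Zp p). d = padic_of_int p (int p ^ m) \<otimes>\<^bsub>Zp p\<^esub> c"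
    then show "d m = 0" by (auto simp: padic_of_int_eq[OF assms(1)] Zp_simps(2))
  next
    assume dm: "d m = 0"
    define c where "c k = d (k + m) div int p ^ m" for k
    have dvd: "int p ^ m dvd d (k + m)" for k
    proof (induction k)
      case 0
      show ?case using dm by simp
    next
      case (Suc k)
      have "[d (Suc (k + m)) = d (k + m)] (mod int p ^ m)"
        by (rule cong_dvd_modulus[OF Zp_cong_Suc[OF d]]) (simp add: le_imp_power_dvd)
      with Suc show ?case by (simp add: cong_dvd_iff)
    qed
    then have c: "d (k + m) = int p ^ m * c k" for k by (simp add: c_def)
    have pos: "int p ^ m > 0" using assms by simp
    have "c \<in> carrier (Zp p)"
      unfolding Zp_simps
    proof (intro allI conjI)
      fix k
      have dk: "0 \<le> d (k + m)" "d (k + m) < int p ^ (k + m)"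
        "d (Suc (k + m)) mod int p ^ (k + m) = d (k + m)"
        using d by (auto simp: Zp_simps)
      show "0 \<le> c k" using dk(1) pos by (simp only: c zero_le_mult_iff) linarith
      have "int p ^ m * c k < int p ^ m * int p ^ k"
        using dk(2) by (simp only: c power_add mult.commute)
      then show "c k < int p ^ k" using pos by (simp only: mult_less_cancel_left_pos)
      have "(int p ^ m * c (Suc k)) mod (int p ^ m * int p ^ k) = int p ^ m * c k"
        using dk(3) c[of "Suc k"] c[of k] by (simp only: power_add mult.commute add_Suc)
      then have "int p ^ m * (c (Suc k) mod int p ^ k) = int p ^ m * c k"
        by (simp only: mult_mod_right)
      then show "c (Suc k) mod int p ^ k = c k" using assms(1) by simp
    qed
    moreover have "d = padic_of_int p (int p ^ m) \<otimes>\<^bsub>Zp p\<^esub> c"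
    proof
      fix k
      have "[d (k + j) = d k] (mod int p ^ k)" for j
      proof (induction j)
        case (Suc j)
        have "[d (Suc (k + j)) = d (k + j)] (mod int p ^ k)"
          by (rule cong_dvd_modulus[OF Zp_cong_Suc[OF d]]) (simp add: le_imp_power_dvd)
        with Suc show ?case by (auto intro: cong_trans)
      qed auto
      from this[of m] have "d k mod int p ^ k = (int p ^ m * c k) mod int p ^ k"
        by (simp add: c cong_def)
      moreover have "d k mod int p ^ k = d k" by (simp add: d_eq)
      ultimately show "d k = (padic_of_int p (int p ^ m) \<otimes>\<^bsub>Zp p\<^esub> c) k"
        by (simp add: padic_of_int_eq[OF assms(1)] Zp_simps(2) mod_mult_left_eq)
    qed
    ultimately show "\<exists>c\<in>carrier (Zp p). d = padic_of_int p (int p ^ m) \<otimes>\<^bsub>Zp p\<^esub> c" by blast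
  qed
  with d0 show ?thesis by (simp add: padic_cong_def factor_def d_def)
qed

end

theory Submission
  imports Defs
begin

text \<open>
  A root of unity \<open>\<xi> \<in> \<int>\<^sub>p\<close> with \<open>\<xi>\<^sup>n = 1\<close> is determined by its residue modulo \<open>p\<close>, because \<open>p\<close> is
  odd; so \<open>\<xi>\<close> is its own Teichmueller representative, its order is \<open>d = ord\<^sub>p(\<xi>)\<close>, and \<open>d\<close> divides both
  \<open>n\<close> and \<open>p - 1\<close>. Each of the two equations splits into a condition modulo \<open>d\<close>, namely
  \<open>x\<^sup>n \<equiv> 1\<close> (respectively \<open>x\<^sub>0\<^sup>n \<equiv> 1\<close>), and a condition on the distance between \<open>x\<close> and \<open>\<xi>\<close>.

  Modulo \<open>p\<^sup>e\<close>, the equation says \<open>x\<^bsup>x^n - 1\<^esup> \<equiv> 1\<close>. Modulo \<open>p\<close> this forces \<open>d\<close> to divide \<open>x\<^sup>n - 1\<close>. Put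
  \<open>t = x\<^sup>d\<close>, which is \<open>1\<close> modulo \<open>p\<close>. Lifting the exponent (\<open>lifting_the_exponent\<close>), applied to the
  exponent \<open>(x\<^sup>n - 1) / d\<close> and once more to \<open>x\<^sup>n - 1 = t\<^bsup>n/d\<^esup> - 1\<close>, turns the equation into
  \<open>p\<^sup>e | n (t - 1)\<^sup>2\<close>. Half of \<open>e - v\<^sub>p(n)\<close>, rounded up, is therefore the number \<open>k\<close> of \<open>p\<close>-adic digits in
  which \<open>t\<close> must agree with \<open>1\<close>, and a third application shows that this means \<open>x \<equiv> \<xi>\<close> modulo \<open>p\<^sup>k\<close>
  (\<open>self_power_cong_iff\<close>). One digit is required in any case, which separates the two cases of the
  formula. The moduli \<open>p\<^sup>k\<close> and \<open>d\<close> are coprime and their product divides \<open>p\<^sup>e (p - 1)\<close>, so the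
  solutions are counted by the Chinese remainder theorem.

  In \<open>\<int>\<^sub>p\<close>, the distance condition is \<open>exp (x\<^sup>n log u) = u\<close> for \<open>u = \<langle>x\<rangle>\<close>. Since \<open>exp\<close> and \<open>log\<close> are inverse
  to each other (\<open>padic_exp_eq_iff_log\<close>), it says \<open>(x\<^sup>n - 1) log u = 0\<close>, so \<open>x\<^sup>n = 1\<close> or \<open>u = 1\<close>, and
  both mean \<open>x = \<xi>\<close>.

  That \<open>exp\<close> and \<open>log\<close> are inverse is proved without composing power series. For \<open>q = p\<^sup>m\<close> one has
  \<open>exp(y)\<^sup>q \<equiv> 1 + q y\<close> and \<open>u\<^sup>q \<equiv> 1 + q log u\<close> modulo \<open>q\<^sup>2\<close> (\<open>padic_exp_power_cong\<close>,
  \<open>padic_log_power_cong\<close>). Hence \<open>exp y = u\<close> gives \<open>y \<equiv> log u\<close> modulo \<open>p\<^sup>m\<close> for all \<open>m\<close>. Conversely, if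
  \<open>y = log u\<close>, then \<open>exp(y)\<^sup>q\<close> and \<open>u\<^sup>q\<close> agree modulo \<open>q\<^sup>2\<close>, so \<open>exp y\<close> and \<open>u\<close> agree modulo \<open>q\<close> by lifting the
  exponent. Both congruences are statements about the divided powers \<open>y\<^sup>k / k!\<close>, which lie in \<open>\<int>\<^sub>p\<close>
  and multiply by \<open>(y\<^sup>i / i!) (y\<^sup>j / j!) = (i + j choose i) y\<^bsup>i+j\<^esup> / (i + j)!\<close>; no denominators remain.
\<close>

section \<open>Lifting the exponent\<close>

lemma prime_power_dvd_unit_mult_iff:
  fixes s x :: int
  assumes "prime p" and "\<not> int p dvd s"
  shows "int p ^ e dvd s * x \<longleftrightarrow> int p ^ e dvd x"
proof -
  have "coprime (int p) s"
    using assms by (simp add: prime_imp_coprime)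
  then show ?thesis
    by (simp add: coprime_dvd_mult_right_iff)
qed

lemma prime_not_dvd_power:
  fixes a :: int
  assumes "prime p" and "\<not> int p dvd a"
  shows "\<not> int p dvd a ^ k"
  using assms prime_dvd_power[of "int p" a k] by auto

lemma power_diff_cofactor_not_dvd:
  fixes a b :: int
  assumes p: "prime p" and ab: "[a = b] (mod int p)" and a: "\<not> int p dvd a" and m: "\<not> p dvd m"
  shows "\<not> int p dvd (\<Sum>i<m. b ^ (m - Suc i) * a ^ i)"
proof -
  have "[(\<Sum>i<m. b ^ (m - Suc i) * a ^ i) = (\<Sum>i<m. a ^ (m - 1))] (mod int p)"
  proof (rule cong_sum)
    fix i assume "i \<in> {..<m}"
    then have "m - 1 = (m - Suc i) + i" by auto
    then have "a ^ (m - 1) = a ^ (m - Suc i) * a ^ i" by (metis power_add)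
    then show "[b ^ (m - Suc i) * a ^ i = a ^ (m - 1)] (mod int p)"
      using cong_sym[OF ab] by (auto intro!: cong_mult cong_pow)
  qed
  moreover have "\<not> int p dvd (\<Sum>i<m. a ^ (m - 1))"
    using p m prime_not_dvd_power[OF p a] by (simp add: prime_dvd_mult_iff)
  ultimately show ?thesis
    by (simp add: cong_dvd_iff)
qed

text \<open>
  Writing \<open>b = a + p c\<close> and expanding to first order, the cofactor is
  \<open>p a\<^sup>p\<^sup>-\<^sup>1 + p c a\<^sup>p\<^sup>-\<^sup>2 (0 + 1 + \<dots> + (p - 1))\<close> modulo \<open>p\<^sup>2\<close>. The last sum is \<open>p (p - 1) / 2\<close>, which is
  divisible by \<open>p\<close> because \<open>p\<close> is odd.
\<close>

lemma prime_power_diff_cofactor: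
  fixes a b :: int
  assumes p: "prime p" "p \<noteq> 2" and ab: "[a = b] (mod int p)" and a: "\<not> int p dvd a"
  obtains s where "(\<Sum>i<p. b ^ (p - Suc i) * a ^ i) = int p * s" and "\<not> int p dvd s"
proof -
  let ?S = "\<Sum>i<p. b ^ (p - Suc i) * a ^ i"
  have "odd p" using p by (metis prime_odd_nat prime_gt_1_nat prime_ge_2_nat le_neq_implies_less)
  then obtain h where h: "p = 2 * h + 1" by (auto elim: oddE)
  obtain c where c: "b = a + int p * c"
    using ab by (metis cong_iff_lin mult.commute)
  have first_order: "[b ^ k = a ^ k + int k * (int p * c) * a ^ (k - 1)] (mod int p ^ 2)" for k
  proof (induction k)
    case (Suc k)
    have eq: "a * (int k * x * a ^ (k - 1)) = int k * x * a ^ k" for x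
      by (cases k) simp_all
    have "[b * b ^ k = (a + int p * c) * (a ^ k + int k * (int p * c) * a ^ (k - 1))] (mod int p ^ 2)"
      unfolding c[symmetric] by (intro cong_mult cong_refl Suc)
    also have "(a + int p * c) * (a ^ k + int k * (int p * c) * a ^ (k - 1)) =
      a ^ Suc k + int (Suc k) * (int p * c) * a ^ k + int p ^ 2 * (int k * c * c * a ^ (k - 1))"
      unfolding distrib_right distrib_left eq by (simp add: algebra_simps power2_eq_square)
    also have "[\<dots> = a ^ Suc k + int (Suc k) * (int p * c) * a ^ k] (mod int p ^ 2)"
      by (simp add: cong_iff_dvd_diff)
    finally show ?case by simp
  qed simp
  have "[?S = (\<Sum>i<p. a ^ (p - 1) + int p * c * a ^ (p - 2) * int (p - Suc i))] (mod int p ^ 2)"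
  proof (rule cong_sum)
    fix i assume i: "i \<in> {..<p}"
    have "[b ^ (p - Suc i) * a ^ i = (a ^ (p - Suc i) +
        int (p - Suc i) * (int p * c) * a ^ (p - Suc i - 1)) * a ^ i] (mod int p ^ 2)"
      by (intro cong_mult first_order cong_refl)
    also have "(a ^ (p - Suc i) + int (p - Suc i) * (int p * c) * a ^ (p - Suc i - 1)) * a ^ i =
        a ^ (p - Suc i + i) + int p * c * (int (p - Suc i) * a ^ (p - Suc i - 1 + i))"
      by (simp add: algebra_simps power_add)
    also have "a ^ (p - Suc i + i) = a ^ (p - 1)" using i by simp
    also have "int (p - Suc i) * a ^ (p - Suc i - 1 + i) = int (p - Suc i) * a ^ (p - 2)"
    proof (cases "p - Suc i")
      case (Suc k)
      then have "p - Suc i - 1 + i = p - 2" by simp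
      then show ?thesis by simp
    qed simp
    finally show "[b ^ (p - Suc i) * a ^ i =
        a ^ (p - 1) + int p * c * a ^ (p - 2) * int (p - Suc i)] (mod int p ^ 2)"
      by (simp add: mult_ac)
  qed
  also have "(\<Sum>i<p. a ^ (p - 1) + int p * c * a ^ (p - 2) * int (p - Suc i)) =
      int p * a ^ (p - 1) + int p * c * a ^ (p - 2) * (\<Sum>i<p. int (p - Suc i))"
    by (simp add: sum.distrib sum_distrib_left)
  also have "(\<Sum>i<p. int (p - Suc i)) = (\<Sum>i<p. int i)"
    by (rule sum.nat_diff_reindex)
  also have "(\<Sum>i<p. int i) = int p * int h"
  proof -
    have "2 * (\<Sum>i<k. int i) = int k * (int k - 1)" for k
      by (induction k) (auto simp: algebra_simps)
    from this[of p] show ?thesis using h by simp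
  qed
  also have "int p * a ^ (p - 1) + int p * c * a ^ (p - 2) * (int p * int h) =
      int p * a ^ (p - 1) + int p ^ 2 * (c * a ^ (p - 2) * int h)"
    by (simp add: algebra_simps power2_eq_square)
  also have "[\<dots> = int p * a ^ (p - 1)] (mod int p ^ 2)"
    by (simp add: cong_iff_dvd_diff)
  finally obtain k where k: "?S = int p * a ^ (p - 1) + int p ^ 2 * k"
    by (metis cong_iff_lin cong_sym mult.commute)
  show thesis
  proof
    show "?S = int p * (a ^ (p - 1) + int p * k)"
      unfolding k by (simp add: algebra_simps power2_eq_square)
    show "\<not> int p dvd a ^ (p - 1) + int p * k"
      using prime_not_dvd_power[OF p(1) a] by (simp add: dvd_add_left_iff)
  qed
qed

text \<open>
  Lifting the exponent. The statement is an equivalence for every \<open>e\<close> rather than an equation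
  between valuations, so that \<open>a\<^sup>m = b\<^sup>m\<close> is no exception, and it carries a factor \<open>c\<close> because that
  is what lets a factor \<open>p\<close> of \<open>m\<close> be moved aside in the induction.
\<close>

lemma lifting_the_exponent:
  fixes a b c :: int
  assumes p: "prime p" "p \<noteq> 2" and ab: "[a = b] (mod int p)" and a: "\<not> int p dvd a"
  shows "int p ^ e dvd c * (a ^ m - b ^ m) \<longleftrightarrow> int p ^ e dvd c * int m * (a - b)"
proof (induction m arbitrary: c rule: less_induct)
  case (less m)
  consider "m = 0" | "\<not> p dvd m" | "m > 0" "p dvd m" by blast
  then show ?case
  proof cases
    case 1
    then show ?thesis by simp
  next
    case 2
    then have "\<not> int p dvd int m" by simp
    then have "int p ^ e dvd c * int m * (a - b) \<longleftrightarrow> int p ^ e dvd c * (a - b)"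
      using prime_power_dvd_unit_mult_iff[OF p(1), of "int m" e "c * (a - b)"]
      by (simp add: mult_ac)
    moreover have "int p ^ e dvd c * (a ^ m - b ^ m) \<longleftrightarrow> int p ^ e dvd c * (a - b)"
      using prime_power_dvd_unit_mult_iff[OF p(1) power_diff_cofactor_not_dvd[OF p(1) ab a 2],
          of e "c * (a - b)"]
      by (simp add: power_diff_sumr2 mult_ac)
    ultimately show ?thesis by simp
  next
    case 3
    then obtain l where l: "m = p * l" by blast
    have "l < m" using 3(1) l prime_gt_1_nat[OF p(1)] by auto
    have "[a ^ l = b ^ l] (mod int p)" "\<not> int p dvd a ^ l"
      using cong_pow[OF ab] prime_not_dvd_power[OF p(1) a] by auto
    from prime_power_diff_cofactor[OF p this] obtain s
      where s: "(\<Sum>i<p. (b ^ l) ^ (p - Suc i) * (a ^ l) ^ i) = int p * s" "\<not> int p dvd s" .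
    have "a ^ m - b ^ m = (a ^ l) ^ p - (b ^ l) ^ p"
      by (simp add: l power_mult[symmetric] mult.commute)
    also have "\<dots> = (a ^ l - b ^ l) * (int p * s)"
      by (simp only: power_diff_sumr2 s(1))
    finally have diff: "a ^ m - b ^ m = (a ^ l - b ^ l) * (int p * s)" .
    have move: "c * (a ^ m - b ^ m) = s * (c * int p * (a ^ l - b ^ l))"
      unfolding diff by (simp add: mult_ac)
    have "int p ^ e dvd c * (a ^ m - b ^ m) \<longleftrightarrow> int p ^ e dvd c * int p * (a ^ l - b ^ l)"
      unfolding move by (rule prime_power_dvd_unit_mult_iff[OF p(1) s(2)])
    also have "\<dots> \<longleftrightarrow> int p ^ e dvd c * int p * int l * (a - b)"
      by (rule less.IH[OF \<open>l < m\<close>])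
    finally show ?thesis by (simp add: l mult_ac)
  qed
qed

section \<open>Divisibility by prime powers\<close>

text \<open>
  That \<open>\<int>\<^sub>p\<close> has no zero divisors, at finite level: a factor \<open>b\<close> that is not divisible by \<open>p\<^sup>j\<close> costs fewer than
  \<open>j\<close> digits.
\<close>

lemma prime_power_dvd_mult_cancel:
  fixes a b :: int
  assumes p: "prime p" and dvd: "int p ^ (i + j) dvd a * b" and b: "\<not> int p ^ j dvd b"
  shows "int p ^ i dvd a"
proof -
  have "j > 0" using b by (cases j) auto
  have "int p ^ (i + j - 1) dvd a * b"
    by (rule dvd_trans[OF le_imp_power_dvd dvd]) simp
  then show ?thesis
    using prime_elem_power_dvd_cases[of "int p" "i + j - 1" a b i j] p \<open>j > 0\<close> b by auto
qed

text \<open>The source of the halving in the final formula.\<close>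

lemma prime_power_dvd_square_iff:
  fixes s :: int
  assumes p: "prime p"
  shows "int p ^ j dvd s\<^sup>2 \<longleftrightarrow> int p ^ ((j + 1) div 2) dvd s"
proof -
  define h where "h = (j + 1) div 2"
  have h: "j \<le> 2 * h" "2 * h \<le> j + 1" unfolding h_def by linarith+
  have "int p ^ h dvd s" if "int p ^ j dvd s\<^sup>2"
  proof (cases "h = 0")
    case False
    have "int p ^ (2 * h - 1) dvd s * s"
      using dvd_trans[OF le_imp_power_dvd[of "2 * h - 1" j] that] h(2) by (simp add: power2_eq_square)
    then show ?thesis
      using prime_elem_power_dvd_cases[of "int p" "2 * h - 1" s s h h] p False by auto
  qed simp
  moreover have "int p ^ j dvd s\<^sup>2" if "int p ^ h dvd s"
  proof -
    have "int p ^ j dvd int p ^ (2 * h)" using h(1) by (rule le_imp_power_dvd)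
    also have "int p ^ (2 * h) = (int p ^ h)\<^sup>2" by (simp add: power_mult mult.commute)
    also have "\<dots> dvd s\<^sup>2" using that by (rule dvd_power_same)
    finally show ?thesis .
  qed
  ultimately show ?thesis unfolding h_def by blast
qed

lemma prime_power_dvd_mult_nat_iff:
  fixes y :: int
  assumes p: "prime p" and n: "n > 0"
  shows "int p ^ e dvd int n * y \<longleftrightarrow> int p ^ (e - multiplicity p n) dvd y"
proof -
  define v where "v = multiplicity p n"
  obtain l where l: "n = p ^ v * l" "\<not> p dvd l"
    unfolding v_def by (rule multiplicity_decompose'[of n p]) (use n p in auto)
  have p0: "p > 0" using p by (rule prime_gt_0_nat)
  have ny: "int n * y = int l * (int p ^ v * y)"
    unfolding l(1) by simp
  have "int p ^ e dvd int n * y \<longleftrightarrow> int p ^ e dvd int p ^ v * y"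
    unfolding ny by (rule prime_power_dvd_unit_mult_iff[OF p]) (use l(2) in simp)
  also have "\<dots> \<longleftrightarrow> int p ^ (e - v) dvd y"
  proof (cases "e \<le> v")
    case True
    then have "int p ^ e dvd int p ^ v * y" by (intro dvd_mult2 le_imp_power_dvd)
    with True show ?thesis by simp
  next
    case False
    then have "int p ^ e = int p ^ v * int p ^ (e - v)"
      by (simp flip: power_add)
    then show ?thesis using p0 by simp
  qed
  finally show ?thesis unfolding v_def .
qed

section \<open>Counting residues\<close>

text \<open>
  Any interval of \<open>M\<close> consecutive integers is a complete residue system. The range starts at \<open>1\<close>
  to match the solution sets.
\<close>

lemma card_periodic:
  fixes P :: "nat \<Rightarrow> bool"
  assumes period: "\<And>x. P (x + M) = P x"
  shows "card {x \<in> {1..M * K}. P x} = K * card {y \<in> {..<M}. P y}"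
proof -
  define f :: "nat \<Rightarrow> nat" where "f x = of_bool (P x)" for x
  have card: "card {x \<in> A. P x} = sum f A" if "finite A" for A
  proof -
    have "{x \<in> A. P x} = A \<inter> {x. P x}" by blast
    then show ?thesis using that by (simp add: f_def sum_of_bool_eq)
  qed
  have f: "f (x + M) = f x" for x by (simp add: f_def period)
  have shift: "(\<Sum>x = 1..N + M. f x) = (\<Sum>x = 1..N. f x) + (\<Sum>x = 1..M. f x)" for N
  proof (induction N)
    case (Suc N)
    have "(\<Sum>x = 1..Suc N + M. f x) = (\<Sum>x = 1..N + M. f x) + f (Suc N + M)" by simp
    also have "\<dots> = (\<Sum>x = 1..Suc N. f x) + (\<Sum>x = 1..M. f x)"
      unfolding f Suc by simp
    finally show ?case .
  qed simp
  have "(\<Sum>x = 1..M * K. f x) = K * (\<Sum>x = 1..M. f x)"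
  proof (induction K)
    case (Suc K)
    then show ?case using shift[of "M * K"] by (simp add: algebra_simps)
  qed simp
  also have "(\<Sum>x = 1..M. f x) = (\<Sum>x<M. f x)"
  proof (cases M)
    case (Suc m)
    have "(\<Sum>x = 1..Suc m. f x) = (\<Sum>x = 1..m. f x) + f 0"
      using f[of 0] Suc by simp
    also have "\<dots> = (\<Sum>x<Suc m. f x)"
      unfolding sum.lessThan_Suc_shift using sum.atLeast1_atMost_eq[of f m] by simp
    finally show ?thesis using Suc by simp
  qed simp
  finally show ?thesis by (simp only: card finite_atLeastAtMost finite_lessThan)
qed

lemma card_chinese_remainder:
  fixes A B a :: nat
  assumes cop: "coprime A B" and pos: "A > 0" "B > 0" and Q: "\<And>x. Q (x mod B) = Q x"
  shows "card {x \<in> {..<A * B}. [x = a] (mod A) \<and> Q x} = card {y \<in> {..<B}. Q y}"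
proof (rule bij_betw_same_card[of "\<lambda>x. x mod B"], rule bij_betw_imageI)
  show "inj_on (\<lambda>x. x mod B) {x \<in> {..<A * B}. [x = a] (mod A) \<and> Q x}"
  proof (rule inj_onI, clarify)
    fix x y
    assume "[x = a] (mod A)" "[y = a] (mod A)" "x mod B = y mod B"
      and less: "x < A * B" "y < A * B"
    then have "[x = y] (mod A)" "[x = y] (mod B)"
      using cong_trans[OF _ cong_sym] by (blast, simp add: cong_def)
    then have "[x = y] (mod A * B)" using cop by (rule coprime_cong_mult_nat)
    then show "x = y" using less by (rule cong_less_modulus_unique_nat)
  qed
  show "(\<lambda>x. x mod B) ` {x \<in> {..<A * B}. [x = a] (mod A) \<and> Q x} = {y \<in> {..<B}. Q y}"
  proof (intro equalityI subsetI)
    fix y assume "y \<in> {y \<in> {..<B}. Q y}"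
    then have y: "y < B" "Q y" by auto
    obtain x where x: "x < A * B" "[x = a] (mod A)" "[x = y] (mod B)"
      using binary_chinese_remainder_unique_nat[OF cop, of a y] pos by auto
    then have "x mod B = y" using y(1) by (simp add: cong_def)
    then show "y \<in> (\<lambda>x. x mod B) ` {x \<in> {..<A * B}. [x = a] (mod A) \<and> Q x}"
      using x y(2) Q[of x] by (intro image_eqI[of _ _ x]) auto
  qed (use pos Q in auto)
qed

lemma num_unity_roots_eq: "num_unity_roots n d = card {y \<in> {..<d}. [y ^ n = 1] (mod d)}"
proof -
  have iff: "[int y ^ n - 1 = 0] (mod int d) \<longleftrightarrow> [y ^ n = 1] (mod d)" for y
    using cong_int_iff[of "y ^ n" 1 d] by (simp add: cong_diff_iff_cong_0)
  have "{z :: int. 0 \<le> z \<and> z < int d \<and> [z ^ n - 1 = 0] (mod int d)} =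
      int ` {y \<in> {..<d}. [y ^ n = 1] (mod d)}"
    (is "?Z = int ` ?Y")
  proof (intro equalityI subsetI)
    fix z assume z: "z \<in> ?Z"
    then have "z = int (nat z)" by simp
    moreover from this have "nat z \<in> ?Y" using z iff[of "nat z"] by auto
    ultimately show "z \<in> int ` ?Y" by blast
  qed (use iff in auto)
  then show ?thesis
    unfolding num_unity_roots_def by (simp add: card_image)
qed

section \<open>Factorials, binomial coefficients and divided powers modulo prime powers\<close>

text \<open>
  From Legendre's recursion \<open>v\<^sub>p(n!) = \<lfloor>n/p\<rfloor> + v\<^sub>p(\<lfloor>n/p\<rfloor>!)\<close>, induction gives \<open>2 v\<^sub>p(n!) \<le> 3 \<lfloor>n/p\<rfloor> \<le> n\<close>,
  where the last step needs \<open>p \<ge> 3\<close>. This bound makes \<open>y\<^sup>k / k!\<close> integral and convergent to \<open>0\<close> for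
  \<open>y \<in> p\<int>\<^sub>p\<close>.
\<close>

lemma two_multiplicity_fact_le:
  assumes p: "prime p" "p \<noteq> 2"
  shows "2 * multiplicity p (fact n :: nat) \<le> n"
proof -
  have step: "multiplicity p (fact n :: nat) = n div p + multiplicity p (fact (n div p) :: nat)" for n
  proof (induction n)
    case (Suc n)
    have split: "multiplicity p (fact (Suc k) :: nat) =
        multiplicity p (Suc k) + multiplicity p (fact k :: nat)" for k
      unfolding fact_Suc of_nat_id using p(1)
      by (intro prime_elem_multiplicity_mult_distrib) auto
    show ?case
    proof (cases "p dvd Suc n")
      case True
      then obtain k where k: "Suc n = p * k" by blast
      then obtain l where l: "k = Suc l" by (cases k) auto
      have p0: "p > 0" using p(1) prime_gt_0_nat by blast
      have n: "n div p = l"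
        by (rule div_nat_eqI) (use k l p0 in \<open>auto simp: algebra_simps\<close>)
      have "multiplicity p (p * k) = Suc (multiplicity p k)"
        using p(1) l by (intro multiplicity_times_same) auto
      moreover have "Suc n div p = Suc l" using k l p0 by simp
      ultimately show ?thesis
        using split[of n] Suc.IH n k l split[of l] by simp
    next
      case False
      then have "Suc n div p = n div p"
        by (simp add: div_Suc mod_eq_0_iff_dvd)
      moreover have "multiplicity p (Suc n) = 0"
        using False by (rule not_dvd_imp_multiplicity_0)
      ultimately show ?thesis using Suc.IH split[of n] by simp
    qed
  qed simp
  show ?thesis
  proof (induction n rule: less_induct)
    case (less n)
    show ?case
    proof (cases "n = 0")
      case False
      have p3: "p \<ge> 3" using p prime_ge_2_nat[OF p(1)] by linarith
      then have "n div p < n" using False by simp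
      then have IH: "2 * multiplicity p (fact (n div p) :: nat) \<le> n div p"
        by (rule less.IH)
      have "2 * multiplicity p (fact n :: nat) =
          2 * (n div p) + 2 * multiplicity p (fact (n div p) :: nat)"
        by (subst step) (rule add_mult_distrib2)
      also have "\<dots> \<le> 2 * (n div p) + n div p"
        by (intro add_left_mono IH)
      also have "\<dots> = 3 * (n div p)" by simp
      also have "3 * (n div p) \<le> p * (n div p)" using p3 by (rule mult_right_mono) simp
      also have "\<dots> \<le> n" by simp
      finally show ?thesis .
    qed simp
  qed
qed

text \<open>
  Here \<open>i! (q - 1 choose i) = (q - 1) (q - 2) \<dots> (q - i)\<close>. This replaces binomial coefficients by the
  coefficients of the logarithm series.
\<close>

lemma fact_mult_binomial_cong:
  assumes "q > 0"
  shows "[fact i * int ((q - 1) choose i) = (- 1) ^ i * fact i] (mod int q)"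
proof (induction i)
  case (Suc i)
  have "Suc i * ((q - 1) choose Suc i) = (q - 1 - i) * ((q - 1) choose i)"
    by (simp only: binomial_absorption binomial_absorb_comp)
  then have "int (Suc i) * int ((q - 1) choose Suc i) = int (q - 1 - i) * int ((q - 1) choose i)"
    by (simp only: of_nat_mult[symmetric])
  also have "\<dots> = (int q - (1 + int i)) * int ((q - 1) choose i)"
    using assms by (cases "i \<le> q - 1") (auto simp: of_nat_diff binomial_eq_0)
  finally have eq: "int (Suc i) * int ((q - 1) choose Suc i) =
    (int q - (1 + int i)) * int ((q - 1) choose i)" .
  have "fact (Suc i) * int ((q - 1) choose Suc i) =
      (int (Suc i) * int ((q - 1) choose Suc i)) * fact i"
    by simp
  also have "\<dots> = (int q - (1 + int i)) * (fact i * int ((q - 1) choose i))"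
    unfolding eq by simp
  also have "[\<dots> = (0 - (1 + int i)) * ((- 1) ^ i * fact i)] (mod int q)"
    by (intro cong_mult Suc cong_diff) (auto simp: cong_def)
  also have "(0 - (1 + int i)) * ((- 1) ^ i * fact i) = (- 1) ^ Suc i * fact (Suc i)"
    by (simp add: algebra_simps)
  finally show ?case .
qed simp

text \<open>
  The functional equation \<open>exp (s y) exp (t y) = exp ((s + t) y)\<close>, with \<open>\<tau> k\<close> in the role of \<open>y\<^sup>k / k!\<close>.
  Modulo \<open>Q\<close> the series are finite sums, and the multiplication rule of divided powers makes the
  Cauchy product a binomial expansion.
\<close>

lemma divided_power_exp_add:
  fixes \<tau> :: "nat \<Rightarrow> int"
  assumes mult: "\<And>i j. [\<tau> i * \<tau> j = int ((i + j) choose i) * \<tau> (i + j)] (mod Q)"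
    and vanish: "\<And>k. k \<ge> N \<Longrightarrow> [\<tau> k = 0] (mod Q)"
  shows "[(\<Sum>k<N. s ^ k * \<tau> k) * (\<Sum>k<N. t ^ k * \<tau> k) = (\<Sum>k<N. (s + t) ^ k * \<tau> k)] (mod Q)"
proof -
  define g where "g i j = s ^ i * t ^ j * (int ((i + j) choose i) * \<tau> (i + j))" for i j
  have "(\<Sum>k<N. s ^ k * \<tau> k) * (\<Sum>k<N. t ^ k * \<tau> k) =
      (\<Sum>(i, j)\<in>{..<N} \<times> {..<N}. s ^ i * t ^ j * (\<tau> i * \<tau> j))"
    by (simp add: sum_product sum.cartesian_product mult_ac)
  also have "[\<dots> = (\<Sum>(i, j)\<in>{..<N} \<times> {..<N}. if i + j < N then g i j else 0)] (mod Q)"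
  proof (rule cong_sum, clarify)
    fix i j
    have g: "[s ^ i * t ^ j * (\<tau> i * \<tau> j) = g i j] (mod Q)"
      unfolding g_def by (intro cong_mult mult cong_refl)
    also have "[g i j = (if i + j < N then g i j else 0)] (mod Q)"
      using vanish[of "i + j"] by (auto simp: g_def cong_0_iff)
    finally show "[s ^ i * t ^ j * (\<tau> i * \<tau> j) = (if i + j < N then g i j else 0)] (mod Q)" .
  qed
  also have "(\<Sum>(i, j)\<in>{..<N} \<times> {..<N}. if i + j < N then g i j else 0) =
      (\<Sum>(i, j)\<in>{(i, j). i + j < N}. g i j)"
    by (rule sum.mono_neutral_cong_right) (auto split: if_splits)
  also have "\<dots> = (\<Sum>k<N. \<Sum>i\<le>k. g i (k - i))"
    by (rule sum.triangle_reindex)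
  also have "\<dots> = (\<Sum>k<N. (s + t) ^ k * \<tau> k)"
    by (intro sum.cong refl) (simp add: g_def binomial_ring sum_distrib_left sum_distrib_right mult_ac)
  finally show ?thesis .
qed

lemma divided_power_exp_power:
  fixes \<tau> :: "nat \<Rightarrow> int"
  assumes mult: "\<And>i j. [\<tau> i * \<tau> j = int ((i + j) choose i) * \<tau> (i + j)] (mod Q)"
    and vanish: "\<And>k. k \<ge> N \<Longrightarrow> [\<tau> k = 0] (mod Q)"
    and one: "[\<tau> 0 = 1] (mod Q)" and N: "N > 0"
  shows "[(\<Sum>k<N. \<tau> k) ^ s = (\<Sum>k<N. int s ^ k * \<tau> k)] (mod Q)"
proof (induction s)
  case 0
  have "(\<Sum>k<N. int 0 ^ k * \<tau> k) = (\<Sum>k<N. if k = 0 then \<tau> 0 else 0)"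
    by (intro sum.cong) auto
  also have "\<dots> = \<tau> 0" using N by simp
  finally show ?case using one by (simp add: cong_sym)
next
  case (Suc s)
  have "[(\<Sum>k<N. \<tau> k) * (\<Sum>k<N. \<tau> k) ^ s =
      (\<Sum>k<N. 1 ^ k * \<tau> k) * (\<Sum>k<N. int s ^ k * \<tau> k)] (mod Q)"
    using Suc by (intro cong_mult) auto
  also have "[(\<Sum>k<N. 1 ^ k * \<tau> k) * (\<Sum>k<N. int s ^ k * \<tau> k) =
      (\<Sum>k<N. (1 + int s) ^ k * \<tau> k)] (mod Q)"
    by (rule divided_power_exp_add[OF mult vanish])
  finally show ?case by simp
qed

section \<open>The ring of p-adic integers by residues\<close>

locale odd_prime =
  fixes p :: nat
  assumes prime: "prime p" and odd: "p \<noteq> 2"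
begin

lemma p_pos: "p > 0"
  using prime by (rule prime_gt_0_nat)

sublocale cring "Zp p"
  by (rule cring_Zp[OF p_pos])

lemma level_mod: "x \<in> carrier (Zp p) \<Longrightarrow> x k mod int p ^ k = x k"
  by (simp add: Zp_simps)

lemma level_cong:
  assumes x: "x \<in> carrier (Zp p)" and "j \<le> k"
  shows "[x k = x j] (mod int p ^ j)"
  using \<open>j \<le> k\<close>
proof (induction k rule: dec_induct)
  case (step k)
  have "[x (Suc k) = x k] (mod int p ^ j)"
    by (rule cong_dvd_modulus[OF Zp_cong_Suc[OF x]]) (use step in \<open>simp add: le_imp_power_dvd\<close>)
  then show ?case using step.IH by (rule cong_trans)
qed simp

lemma level_eq_iff:
  assumes "x \<in> carrier (Zp p)" and "y \<in> carrier (Zp p)"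
  shows "x k = y k \<longleftrightarrow> [x k = y k] (mod int p ^ k)"
  using assms by (simp add: cong_def level_mod)

lemma padic_eqI:
  assumes "x \<in> carrier (Zp p)" and "y \<in> carrier (Zp p)"
    and "\<And>k. [x k = y k] (mod int p ^ k)"
  shows "x = y"
  using assms by (simp add: fun_eq_iff level_eq_iff)

lemma level_eq_0_iff:
  assumes "x \<in> carrier (Zp p)" and "j \<le> k"
  shows "x j = 0 \<longleftrightarrow> int p ^ j dvd x k"
  using level_eq_iff[OF assms(1) zero_closed, of j] level_cong[OF assms]
  by (simp add: Zp_simps cong_0_iff cong_dvd_iff)

text \<open>
  An element of \<open>p\<int>\<^sub>p\<close> appears below as \<open>x\<close> with \<open>x 1 = 0\<close>, an element of \<open>1 + p\<int>\<^sub>p\<close> as \<open>u\<close> with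
  \<open>u 1 = 1\<close>, and a unit as \<open>x\<close> with \<open>x 1 \<noteq> 0\<close>.
\<close>

lemma level_1_eq_0:
  assumes "x \<in> carrier (Zp p)" and "x 1 = 0" and "k > 0"
  shows "int p dvd x k"
  using level_eq_0_iff[OF assms(1), of 1 k] assms(2,3) by simp

lemma level_mult: "[(x \<otimes>\<^bsub>Zp p\<^esub> y) k = x k * y k] (mod int p ^ k)"
  by (simp add: Zp_simps)

lemma level_one: "[\<one>\<^bsub>Zp p\<^esub> k = 1] (mod int p ^ k)"
  by (simp add: Zp_simps)

lemma level_of_int: "[padic_of_int p m k = m] (mod int p ^ k)"
  by (simp add: padic_of_int_eq[OF p_pos])

lemma level_of_int_mult: "[(padic_of_int p m \<otimes>\<^bsub>Zp p\<^esub> y) k = m * y k] (mod int p ^ k)"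
  using level_mult[of "padic_of_int p m" y k] cong_scalar_right[OF level_of_int[of m k], of "y k"]
  by (rule cong_trans)

lemma padic_of_int_closed [simp]: "padic_of_int p m \<in> carrier (Zp p)"
  unfolding padic_of_int_def by simp

lemma level_minus:
  assumes "x \<in> carrier (Zp p)" and "y \<in> carrier (Zp p)"
  shows "[(x \<ominus>\<^bsub>Zp p\<^esub> y) k = x k - y k] (mod int p ^ k)"
  using Zp_minus[OF p_pos assms(2)]
  by (simp add: a_minus_def Zp_simps(3) cong_def mod_simps)

lemma level_pow:
  assumes "x \<in> carrier (Zp p)"
  shows "[(x [^]\<^bsub>Zp p\<^esub> (m :: nat)) k = x k ^ m] (mod int p ^ k)"
proof (induction m)
  case 0
  show ?case unfolding nat_pow_0 power_0 by (rule level_one)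
next
  case (Suc m)
  have "[(x [^]\<^bsub>Zp p\<^esub> m \<otimes>\<^bsub>Zp p\<^esub> x) k = (x [^]\<^bsub>Zp p\<^esub> m) k * x k] (mod int p ^ k)"
    by (rule level_mult)
  also have "[(x [^]\<^bsub>Zp p\<^esub> m) k * x k = x k ^ m * x k] (mod int p ^ k)"
    using Suc by (rule cong_scalar_right)
  finally show ?case unfolding nat_pow_Suc power_Suc2 .
qed

lemma level_finsum:
  assumes "\<And>i. f i \<in> carrier (Zp p)"
  shows "[finsum (Zp p) f {..<N :: nat} k = (\<Sum>i<N. f i k)] (mod int p ^ k)"
proof (induction N)
  case 0
  then show ?case by (simp add: Zp_simps)
next
  case (Suc N)
  have "finsum (Zp p) f {..<Suc N} k = (f N k + finsum (Zp p) f {..<N} k) mod int p ^ k"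
    using assms by (simp add: lessThan_Suc Pi_def Zp_simps(3))
  also have "[\<dots> = f N k + (\<Sum>i<N. f i k)] (mod int p ^ k)"
    using Suc by (auto intro: cong_add)
  finally show ?case by (simp add: add.commute)
qed

text \<open>
  Equalities in \<open>\<int>\<^sub>p\<close> that involve division by \<open>m\<close> are proved by clearing the denominator on residues.
\<close>

lemma padic_int_mult_cancel:
  assumes x: "x \<in> carrier (Zp p)" and y: "y \<in> carrier (Zp p)" and m: "m > 0"
    and eq: "\<And>k. [int m * x k = int m * y k] (mod int p ^ k)"
  shows "x = y"
proof (rule padic_eqI[OF x y])
  fix k
  \<comment> \<open>Any \<open>j\<close> with \<open>p\<^sup>j\<close> not dividing \<open>m\<close> will do as the number of lost digits; \<open>j = m\<close> is one.\<close>
  have "m < p ^ m" using prime_gt_1_nat[OF prime] by (simp add: power_gt_expt)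
  then have m': "\<not> int p ^ m dvd int m"
    unfolding of_nat_power[symmetric] of_nat_dvd_iff using m dvd_imp_le[of "p ^ m" m] by linarith
  have "int p ^ (k + m) dvd (x (k + m) - y (k + m)) * int m"
    using eq[of "k + m"] unfolding cong_iff_dvd_diff by (simp only: mult.commute[of _ "int m"] right_diff_distrib)
  then have "int p ^ k dvd x (k + m) - y (k + m)"
    using m' by (rule prime_power_dvd_mult_cancel[OF prime])
  then have "[x (k + m) = y (k + m)] (mod int p ^ k)"
    unfolding cong_iff_dvd_diff .
  then show "[x k = y k] (mod int p ^ k)"
    using level_cong[OF x le_add1] level_cong[OF y le_add1] by (meson cong_sym cong_trans)
qed

lemma padic_mult_eq_0:
  assumes x: "x \<in> carrier (Zp p)" and y: "y \<in> carrier (Zp p)" and "y \<noteq> \<zero>\<^bsub>Zp p\<^esub>"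
    and eq: "x \<otimes>\<^bsub>Zp p\<^esub> y = \<zero>\<^bsub>Zp p\<^esub>"
  shows "x = \<zero>\<^bsub>Zp p\<^esub>"
proof (rule padic_eqI[OF x zero_closed])
  fix k
  obtain j where "y j \<noteq> 0" using \<open>y \<noteq> \<zero>\<^bsub>Zp p\<^esub>\<close> by (auto simp: Zp_simps)
  then have "\<not> int p ^ j dvd y (k + j)"
    using level_eq_0_iff[OF y, of j "k + j"] by simp
  moreover have "int p ^ (k + j) dvd x (k + j) * y (k + j)"
    using level_mult[of x y "k + j"] by (simp add: eq Zp_simps(5) cong_iff_dvd_diff)
  ultimately have "int p ^ k dvd x (k + j)"
    using prime_power_dvd_mult_cancel[OF prime] by blast
  then show "[x k = \<zero>\<^bsub>Zp p\<^esub> k] (mod int p ^ k)"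
    using level_eq_0_iff[OF x, of k "k + j"] by (simp add: Zp_simps)
qed

lemma level_1_not_dvd:
  assumes "x \<in> carrier (Zp p)" and "x 1 \<noteq> 0" and "k > 0"
  shows "\<not> int p dvd x k"
  using level_eq_0_iff[OF assms(1), of 1 k] assms(2,3) by simp

text \<open>
  The \<open>m\<close>-th power map is injective on the units of a fixed residue class modulo \<open>p\<close>: lifting the
  exponent makes \<open>m x\<close> and \<open>m y\<close> congruent at every level. This yields the uniqueness of Teichmueller
  representatives.
\<close>

lemma padic_pow_inj:
  fixes m :: nat
  assumes x: "x \<in> carrier (Zp p)" and y: "y \<in> carrier (Zp p)" and m: "m > 0"
    and xy: "x 1 = y 1" "x 1 \<noteq> 0"
    and eq: "x [^]\<^bsub>Zp p\<^esub> m = y [^]\<^bsub>Zp p\<^esub> m"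
  shows "x = y"
proof (rule padic_int_mult_cancel[where x = x and y = y, OF x y m])
  fix k
  show "[int m * x k = int m * y k] (mod int p ^ k)"
  proof (cases "k = 0")
    case False
    have 1: "[x k = y k] (mod int p)"
      using cong_trans[OF level_cong[OF x, of 1 k] cong_sym[OF level_cong[OF y, of 1 k, folded xy(1)]]]
        False by simp
    have 2: "\<not> int p dvd x k" using level_1_not_dvd[OF x] xy(2) False by simp
    have "[x k ^ m = y k ^ m] (mod int p ^ k)"
      using cong_trans[OF cong_sym[OF level_pow[OF x, of m k]] level_pow[OF y, of m k, folded eq]] .
    then have "int p ^ k dvd 1 * (x k ^ m - y k ^ m)"
      unfolding cong_iff_dvd_diff by simp
    then have "int p ^ k dvd 1 * int m * (x k - y k)"
      unfolding lifting_the_exponent[OF prime odd 1 2] .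
    then show ?thesis
      unfolding cong_iff_dvd_diff by (simp only: mult_1 right_diff_distrib)
  next
    case True
    show ?thesis unfolding True by simp
  qed
qed

lemma padic_div_nat_eqI:
  assumes x: "x \<in> carrier (Zp p)" and y: "y \<in> carrier (Zp p)" and m: "m > 0"
    and eq: "\<And>k. [int m * y k = x k] (mod int p ^ k)"
  shows "padic_div_nat p x m = y"
  unfolding padic_div_nat_def
proof (rule the_equality)
  note level = level_of_int_mult[of "int m"]
  show "y \<in> carrier (Zp p) \<and> padic_of_int p (int m) \<otimes>\<^bsub>Zp p\<^esub> y = x"
    using x y level eq by (auto intro!: padic_eqI intro: cong_trans)
  show "z = y" if "z \<in> carrier (Zp p) \<and> padic_of_int p (int m) \<otimes>\<^bsub>Zp p\<^esub> z = x" for z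
  proof (rule padic_int_mult_cancel[OF _ y m])
    show "[int m * z k = int m * y k] (mod int p ^ k)" for k
      using that level[of z k] eq[of k] by (metis cong_sym cong_trans)
  qed (use that in simp)
qed

text \<open>
  The inverses of \<open>m\<close> modulo the powers of \<open>p\<close> are compatible because each of them is unique.
\<close>

lemma padic_inverse_of_int:
  assumes "\<not> int p dvd m"
  obtains w where "w \<in> carrier (Zp p)" and "\<And>k. [m * w k = 1] (mod int p ^ k)"
proof -
  have cop: "coprime m (int p ^ k)" for k
    using prime assms prime_imp_coprime[of "int p" m] by (simp add: coprime_commute)
  then have "\<forall>k. \<exists>w. [m * w = 1] (mod int p ^ k)"
    using cong_solve_coprime_int by blast
  then obtain w where w: "\<And>k. [m * w k = 1] (mod int p ^ k)" by metis
  show thesis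
  proof
    show "(\<lambda>k. w k mod int p ^ k) \<in> carrier (Zp p)"
    proof (rule Zp_closed_aux[OF p_pos])
      fix k
      have "[m * w (Suc k) = 1] (mod int p ^ k)"
        by (rule cong_dvd_modulus[OF w[of "Suc k"]]) simp
      then have "[m * w (Suc k) = m * w k] (mod int p ^ k)"
        using w[of k] by (metis cong_sym cong_trans)
      then show "[w (Suc k) = w k] (mod int p ^ k)"
        using cop by (simp add: cong_mult_lcancel)
    qed
    show "[m * (w k mod int p ^ k) = 1] (mod int p ^ k)" for k
      using w[of k] by (simp add: cong_def mod_simps)
  qed
qed

text \<open>
  With \<open>m = p\<^sup>a l\<close> and \<open>l\<close> a unit, the quotient exists as soon as \<open>p\<^sup>a\<close> divides \<open>x\<close>, that is, \<open>x a = 0\<close>.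
\<close>

lemma padic_div_nat:
  assumes x: "x \<in> carrier (Zp p)" and m: "m > 0" and div: "x (multiplicity p m) = 0"
  shows padic_div_nat_closed: "padic_div_nat p x m \<in> carrier (Zp p)"
    and padic_div_nat_level: "[int m * padic_div_nat p x m k = x k] (mod int p ^ k)"
proof -
  define a where "a = multiplicity p m"
  obtain l where l: "m = p ^ a * l" "\<not> p dvd l"
    unfolding a_def by (rule multiplicity_decompose'[of m p]) (use m prime in auto)
  obtain w where w: "w \<in> carrier (Zp p)" "\<And>k. [int l * w k = 1] (mod int p ^ k)"
    using padic_inverse_of_int[of "int l"] l(2) by auto
  have "padic_cong p a x \<zero>\<^bsub>Zp p\<^esub>"
    using padic_cong_iff[OF p_pos x zero_closed] div by (simp add: a_def Zp_simps)
  then obtain c where c: "c \<in> carrier (Zp p)" "x = padic_of_int p (int p ^ a) \<otimes>\<^bsub>Zp p\<^esub> c"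
    using x by (auto simp: padic_cong_def factor_def a_minus_def)
  have y: "c \<otimes>\<^bsub>Zp p\<^esub> w \<in> carrier (Zp p)" using c w by simp
  have eq: "[int m * (c \<otimes>\<^bsub>Zp p\<^esub> w) k = x k] (mod int p ^ k)" for k
  proof -
    have "[int m * (c \<otimes>\<^bsub>Zp p\<^esub> w) k = int m * (c k * w k)] (mod int p ^ k)"
      by (intro cong_mult level_mult cong_refl)
    also have "int m * (c k * w k) = int p ^ a * c k * (int l * w k)"
      by (simp add: l(1) mult_ac)
    also have "[\<dots> = int p ^ a * c k * 1] (mod int p ^ k)"
      by (intro cong_mult w(2) cong_refl)
    also have "[int p ^ a * c k * 1 = x k] (mod int p ^ k)"
      unfolding c(2) mult_1_right
      by (rule cong_sym[OF level_of_int_mult])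
    finally show ?thesis .
  qed
  have "padic_div_nat p x m = c \<otimes>\<^bsub>Zp p\<^esub> w"
    by (rule padic_div_nat_eqI[OF x y m eq])
  then show "padic_div_nat p x m \<in> carrier (Zp p)"
    and "[int m * padic_div_nat p x m k = x k] (mod int p ^ k)"
    using y eq by simp_all
qed

lemma padic_div_nat_eq_0:
  assumes x: "x \<in> carrier (Zp p)" and m: "m > 0" and zero: "x (multiplicity p m + j) = 0"
  shows "padic_div_nat p x m j = 0"
proof -
  define a where "a = multiplicity p m"
  obtain l where l: "m = p ^ a * l" "\<not> p dvd l"
    unfolding a_def by (rule multiplicity_decompose'[of m p]) (use m prime in auto)
  let ?y = "padic_div_nat p x m"
  have "x a = 0"
    using level_eq_0_iff[OF x, of a "a + j"] zero by (simp add: a_def)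
  note y = padic_div_nat[OF x m this[unfolded a_def]]
  have "int p ^ (a + j) dvd int m * ?y (a + j)"
    using y(2)[of "a + j"] zero by (simp add: a_def cong_0_iff)
  then have "int p ^ j dvd int l * ?y (a + j)"
    using p_pos by (simp add: l(1) power_add mult.assoc)
  then have "int p ^ j dvd ?y (a + j)"
    using prime_power_dvd_unit_mult_iff[OF prime, of "int l"] l(2) by simp
  then show ?thesis
    using level_eq_0_iff[OF y(1), of j "a + j"] by simp
qed

text \<open>
  A series converges once its terms vanish at level \<open>j\<close> from an index \<open>K j\<close> on, and its residues are
  then finite sums.
\<close>

lemma padic_suminf:
  assumes f: "\<And>i. f i \<in> carrier (Zp p)" and vanish: "\<And>i j. i \<ge> K j \<Longrightarrow> f i j = 0"
  shows padic_suminf_closed: "padic_suminf p f \<in> carrier (Zp p)"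
    and padic_suminf_level: "N \<ge> K j \<Longrightarrow> [padic_suminf p f j = (\<Sum>i<N. f i j)] (mod int p ^ j)"
proof -
  define s where "s j = (\<Sum>i<K j. f i j) mod int p ^ j" for j
  have tail: "(\<Sum>i<N. f i j) = (\<Sum>i<K j. f i j)" if "N \<ge> K j" for N j
    by (rule sum.mono_neutral_right) (use that vanish in auto)
  have s: "s \<in> carrier (Zp p)"
    unfolding s_def
  proof (rule Zp_closed_aux[OF p_pos])
    fix j
    define N where "N = max (K j) (K (Suc j))"
    have "[(\<Sum>i<N. f i (Suc j)) = (\<Sum>i<N. f i j)] (mod int p ^ j)"
      by (intro cong_sum Zp_cong_Suc f)
    then show "[(\<Sum>i<K (Suc j). f i (Suc j)) = (\<Sum>i<K j. f i j)] (mod int p ^ j)"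
      using tail[of j N] tail[of "Suc j" N] by (simp add: N_def)
  qed
  have fin: "finsum (Zp p) f {..<N} \<in> carrier (Zp p)" for N :: nat
    using f by (intro finsum_closed) auto
  have level: "finsum (Zp p) f {..<N} j = s j" if "N \<ge> K j" for N j
    using level_finsum[where f = f and N = N and k = j, OF f] level_eq_iff[OF fin s] tail[OF that] by (simp add: s_def)
  have "padic_suminf p f = s"
    unfolding padic_suminf_def padic_sums_def
  proof (rule the_equality, intro conjI allI)
    show "s \<in> carrier (Zp p)" by (rule s)
    show "\<forall>\<^sub>F N in sequentially. padic_cong p m (finsum (Zp p) f {..<N}) s" for m
      using level padic_cong_iff[OF p_pos fin s] by (intro eventually_sequentiallyI[of "K m"]) simp
  next
    fix t assume t: "t \<in> carrier (Zp p) \<and>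
      (\<forall>m. \<forall>\<^sub>F N in sequentially. padic_cong p m (finsum (Zp p) f {..<N}) t)"
    show "t = s"
    proof
      fix m
      have "\<forall>\<^sub>F N in sequentially. padic_cong p m (finsum (Zp p) f {..<N}) t \<and> N \<ge> K m"
        using t by (intro eventually_conj eventually_ge_at_top) auto
      then obtain N where "padic_cong p m (finsum (Zp p) f {..<N}) t" "N \<ge> K m"
        by (auto dest: eventually_happens)
      then show "t m = s m"
        using t level padic_cong_iff[OF p_pos fin, of t m N] by simp
    qed
  qed
  then show "padic_suminf p f \<in> carrier (Zp p)"
    and "N \<ge> K j \<Longrightarrow> [padic_suminf p f j = (\<Sum>i<N. f i j)] (mod int p ^ j)"
    using s tail[of j N] by (simp_all only: s_def cong_mod_left cong_refl)
qed

section \<open>Exponential and logarithm\<close>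

text \<open>
  Both series are built from the divided powers of one element: \<open>exp y\<close> is their sum, and the terms
  of \<open>log (1 + w)\<close> are \<open>w\<^bsup>i+1\<^esup> / (i + 1) = i! w\<^bsup>i+1\<^esup> / (i + 1)!\<close>.
\<close>

definition divided_power :: "(nat \<Rightarrow> int) \<Rightarrow> nat \<Rightarrow> (nat \<Rightarrow> int)" where
  "divided_power y k = padic_div_nat p (y [^]\<^bsub>Zp p\<^esub> k) (fact k)"

lemma pow_level_eq_0:
  assumes y: "y \<in> carrier (Zp p)" "y 1 = 0" and "j \<le> k"
  shows "(y [^]\<^bsub>Zp p\<^esub> k) j = 0"
proof (cases "j = 0")
  case True
  have "y [^]\<^bsub>Zp p\<^esub> k \<in> carrier (Zp p)" using y by simp
  then have "0 \<le> (y [^]\<^bsub>Zp p\<^esub> k) 0 \<and> (y [^]\<^bsub>Zp p\<^esub> k) 0 < int p ^ 0"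
    unfolding Zp_simps(1) by blast
  then show ?thesis unfolding True by simp
next
  case False
  have yk: "y [^]\<^bsub>Zp p\<^esub> k \<in> carrier (Zp p)" using y by simp
  have "int p dvd y j" using level_1_eq_0[OF y] False by simp
  then have "int p ^ k dvd y j ^ k" by (rule dvd_power_same)
  then have "int p ^ j dvd y j ^ k"
    using \<open>j \<le> k\<close> by (meson dvd_trans le_imp_power_dvd)
  then have "int p ^ j dvd (y [^]\<^bsub>Zp p\<^esub> k) j"
    using cong_dvd_iff[OF level_pow[OF y(1), of k j]] by simp
  then show ?thesis using level_eq_0_iff[OF yk order_refl] by simp
qed

lemma multiplicity_fact_le: "multiplicity p (fact k :: nat) \<le> k"
  using two_multiplicity_fact_le[OF prime odd, of k] by linarith

lemma
  assumes y: "y \<in> carrier (Zp p)" "y 1 = 0"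
  shows divided_power_closed [intro]: "divided_power y k \<in> carrier (Zp p)"
    and divided_power_level: "[fact k * divided_power y k j = y j ^ k] (mod int p ^ j)"
proof -
  have yk: "y [^]\<^bsub>Zp p\<^esub> k \<in> carrier (Zp p)" using y by simp
  note div = padic_div_nat[OF yk fact_gt_zero pow_level_eq_0[OF y multiplicity_fact_le]]
  show "divided_power y k \<in> carrier (Zp p)"
    unfolding divided_power_def by (rule div(1))
  have "[fact k * divided_power y k j = (y [^]\<^bsub>Zp p\<^esub> k) j] (mod int p ^ j)"
    unfolding divided_power_def using div(2)[of j] by simp
  then show "[fact k * divided_power y k j = y j ^ k] (mod int p ^ j)"
    using level_pow[OF y(1)] by (rule cong_trans)
qed

lemma divided_power_eq_0:
  assumes y: "y \<in> carrier (Zp p)" "y 1 = 0" and "2 * j \<le> k \<or> j = 1 \<and> k > 0"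
  shows "divided_power y k j = 0"
proof -
  have yk: "y [^]\<^bsub>Zp p\<^esub> k \<in> carrier (Zp p)" using y by simp
  have "multiplicity p (fact k :: nat) + j \<le> k"
    using two_multiplicity_fact_le[OF prime odd, of k] assms(3) by linarith
  then show ?thesis
    unfolding divided_power_def
    by (intro padic_div_nat_eq_0[OF yk] pow_level_eq_0[OF y]) auto
qed

text \<open>
  Both sides become \<open>y\<^bsup>i+j\<^esup>\<close> after multiplication by \<open>i! j!\<close>. The cancellation takes place in \<open>\<int>\<^sub>p\<close>,
  since it would lose digits at a single level.
\<close>

lemma divided_power_mult:
  assumes y: "y \<in> carrier (Zp p)" "y 1 = 0"
  shows "[divided_power y i k * divided_power y j k =
    int ((i + j) choose i) * divided_power y (i + j) k] (mod int p ^ k)"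
proof -
  let ?T = "divided_power y" and ?c = "int ((i + j) choose i)"
  have "?T i \<otimes>\<^bsub>Zp p\<^esub> ?T j = padic_of_int p ?c \<otimes>\<^bsub>Zp p\<^esub> ?T (i + j)"
  proof (rule padic_int_mult_cancel[where m = "fact i * fact j"])
    fix l
    have "[int (fact i * fact j) * (?T i \<otimes>\<^bsub>Zp p\<^esub> ?T j) l =
        int (fact i * fact j) * (?T i l * ?T j l)] (mod int p ^ l)"
      by (intro cong_mult cong_refl level_mult)
    also have "int (fact i * fact j) * (?T i l * ?T j l) = (fact i * ?T i l) * (fact j * ?T j l)"
      by (simp add: mult_ac)
    also have "[(fact i * ?T i l) * (fact j * ?T j l) = y l ^ i * y l ^ j] (mod int p ^ l)"
      by (intro cong_mult divided_power_level y)
    finally have left: "[int (fact i * fact j) * (?T i \<otimes>\<^bsub>Zp p\<^esub> ?T j) l = y l ^ (i + j)] (mod int p ^ l)"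
      by (simp only: power_add)
    have "[int (fact i * fact j) * (padic_of_int p ?c \<otimes>\<^bsub>Zp p\<^esub> ?T (i + j)) l =
        int (fact i * fact j) * (?c * ?T (i + j) l)] (mod int p ^ l)"
      by (intro cong_mult cong_refl level_of_int_mult)
    also have "int (fact i * fact j) * (?c * ?T (i + j) l) =
        int (fact i * fact j * ((i + j) choose i)) * ?T (i + j) l"
      by simp
    also have "fact i * fact j * ((i + j) choose i) = fact (i + j)"
      using binomial_fact_lemma[of i "i + j"] by simp
    also have "[int (fact (i + j)) * ?T (i + j) l = y l ^ (i + j)] (mod int p ^ l)"
      using divided_power_level[OF y, of "i + j" l] by simp
    finally have right: "[int (fact i * fact j) * (padic_of_int p ?c \<otimes>\<^bsub>Zp p\<^esub> ?T (i + j)) l =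
        y l ^ (i + j)] (mod int p ^ l)" .
    show "[int (fact i * fact j) * (?T i \<otimes>\<^bsub>Zp p\<^esub> ?T j) l =
        int (fact i * fact j) * (padic_of_int p ?c \<otimes>\<^bsub>Zp p\<^esub> ?T (i + j)) l] (mod int p ^ l)"
      using left cong_sym[OF right] by (rule cong_trans)
  qed (simp_all add: divided_power_closed[OF y])
  then have "[?T i k * ?T j k = (padic_of_int p ?c \<otimes>\<^bsub>Zp p\<^esub> ?T (i + j)) k] (mod int p ^ k)"
    using cong_sym[OF level_mult[of "?T i" "?T j" k]] by simp
  then show ?thesis
    using level_of_int_mult by (rule cong_trans)
qed

lemma
  assumes y: "y \<in> carrier (Zp p)" "y 1 = 0"
  shows padic_exp_closed: "padic_exp p y \<in> carrier (Zp p)"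
    and padic_exp_level:
      "N \<ge> 2 * j \<Longrightarrow> [padic_exp p y j = (\<Sum>k<N. divided_power y k j)] (mod int p ^ j)"
  unfolding padic_exp_def divided_power_def[symmetric]
  by (rule padic_suminf_closed[where K = "\<lambda>j. 2 * j"] padic_suminf_level[where K = "\<lambda>j. 2 * j"],
      use y divided_power_eq_0[OF y] in auto)+

lemma divided_power_0: "y \<in> carrier (Zp p) \<Longrightarrow> y 1 = 0 \<Longrightarrow> [divided_power y 0 j = 1] (mod int p ^ j)"
  using divided_power_level[of y 0 j] by simp

lemma divided_power_1:
  "y \<in> carrier (Zp p) \<Longrightarrow> y 1 = 0 \<Longrightarrow> [divided_power y (Suc 0) j = y j] (mod int p ^ j)"
  using divided_power_level[of y "Suc 0" j] by simp

lemma padic_exp_level_1: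
  assumes y: "y \<in> carrier (Zp p)" "y 1 = 0"
  shows "padic_exp p y 1 = 1"
proof -
  have "[padic_exp p y 1 = (\<Sum>k<2. divided_power y k 1)] (mod int p ^ 1)"
    by (rule padic_exp_level[OF y]) simp
  also have "(\<Sum>k<2. divided_power y k 1) = divided_power y 0 1"
    using divided_power_eq_0[OF y, of 1 1] by (simp add: numeral_2_eq_2)
  also have "[divided_power y 0 1 = 1] (mod int p ^ 1)"
    by (rule divided_power_0[OF y])
  finally have "[padic_exp p y 1 = \<one>\<^bsub>Zp p\<^esub> 1] (mod int p ^ 1)"
    using cong_sym[OF level_one] by (rule cong_trans)
  then have "padic_exp p y 1 = \<one>\<^bsub>Zp p\<^esub> 1"
    using level_eq_iff[OF padic_exp_closed[OF y] one_closed] by blast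
  also have "\<dots> = 1" using prime_gt_1_nat[OF prime] by (simp add: Zp_simps)
  finally show ?thesis .
qed

text \<open>
  By the functional equation, \<open>exp(y)\<^sup>q = exp (q y) = 1 + q y + \<Sum>k\<ge>2. q\<^sup>k y\<^sup>k / k!\<close>, and the tail is divisible
  by \<open>q\<^sup>2\<close> because divided powers are integral. Here \<open>q = p\<^sup>m\<close>, so \<open>q\<^sup>2\<close> belongs to level \<open>2 m\<close>.
\<close>

lemma padic_exp_power_cong:
  assumes y: "y \<in> carrier (Zp p)" "y 1 = 0"
  shows "[padic_exp p y (2 * m) ^ (p ^ m) = 1 + int p ^ m * y (2 * m)] (mod int p ^ (2 * m))"
proof -
  let ?Q = "int p ^ (2 * m)"
  define \<tau> where "\<tau> k = divided_power y k (2 * m)" for k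
  \<comment> \<open>Divided powers vanish at level \<open>2 m\<close> from index \<open>4 m\<close> on; two more keep the first two terms for \<open>m = 0\<close>.\<close>
  define N where "N = 4 * m"
  have mult: "[\<tau> i * \<tau> j = int ((i + j) choose i) * \<tau> (i + j)] (mod ?Q)" for i j
    unfolding \<tau>_def by (rule divided_power_mult[OF y])
  have vanish: "[\<tau> k = 0] (mod ?Q)" if "k \<ge> N + 2" for k
    using divided_power_eq_0[OF y, of "2 * m" k] that by (simp add: \<tau>_def N_def)
  have \<tau>0: "[\<tau> 0 = 1] (mod ?Q)" unfolding \<tau>_def by (rule divided_power_0[OF y])
  have \<tau>1: "[\<tau> (Suc 0) = y (2 * m)] (mod ?Q)" unfolding \<tau>_def by (rule divided_power_1[OF y])
  have "[padic_exp p y (2 * m) = (\<Sum>k<N + 2. \<tau> k)] (mod ?Q)"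
    unfolding \<tau>_def by (rule padic_exp_level[OF y]) (simp add: N_def)
  then have "[padic_exp p y (2 * m) ^ (p ^ m) = (\<Sum>k<N + 2. \<tau> k) ^ (p ^ m)] (mod ?Q)"
    by (rule cong_pow)
  also have "[(\<Sum>k<N + 2. \<tau> k) ^ (p ^ m) = (\<Sum>k<N + 2. int (p ^ m) ^ k * \<tau> k)] (mod ?Q)"
    by (rule divided_power_exp_power[OF mult vanish \<tau>0]) simp_all
  also have "(\<Sum>k<N + 2. int (p ^ m) ^ k * \<tau> k) =
      \<tau> 0 + int p ^ m * \<tau> (Suc 0) + (\<Sum>k<N. int (p ^ m) ^ (k + 2) * \<tau> (k + 2))"
    by (simp add: sum.lessThan_Suc_shift del: sum.lessThan_Suc)
  also have "[\<tau> 0 + int p ^ m * \<tau> (Suc 0) + (\<Sum>k<N. int (p ^ m) ^ (k + 2) * \<tau> (k + 2)) =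
      1 + int p ^ m * y (2 * m) + (\<Sum>k<N. 0)] (mod ?Q)"
  proof (intro cong_add cong_mult cong_sum cong_refl \<tau>0 \<tau>1)
    fix k
    have "?Q dvd int (p ^ m) ^ (k + 2)"
      unfolding of_nat_power power_mult[symmetric] by (rule le_imp_power_dvd) simp
    then show "[int (p ^ m) ^ (k + 2) * \<tau> (k + 2) = 0] (mod ?Q)"
      unfolding cong_0_iff by (rule dvd_mult2)
  qed
  finally show ?thesis by simp
qed

lemma padic_log_term:
  assumes w: "w \<in> carrier (Zp p)" "w 1 = 0"
  defines "t \<equiv> \<lambda>i. (\<ominus>\<^bsub>Zp p\<^esub> \<one>\<^bsub>Zp p\<^esub>) [^]\<^bsub>Zp p\<^esub> (i :: nat) \<otimes>\<^bsub>Zp p\<^esub>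
     padic_div_nat p (w [^]\<^bsub>Zp p\<^esub> Suc i) (Suc i)"
  shows "t i \<in> carrier (Zp p)"
    and "[t i j = (- 1) ^ i * fact i * divided_power w (Suc i) j] (mod int p ^ j)"
proof -
  let ?S = "padic_of_int p (fact i) \<otimes>\<^bsub>Zp p\<^esub> divided_power w (Suc i)"
  have S: "?S \<in> carrier (Zp p)" by (simp add: divided_power_closed[OF w])
  have div: "padic_div_nat p (w [^]\<^bsub>Zp p\<^esub> Suc i) (Suc i) = ?S"
  proof (rule padic_div_nat_eqI[OF _ S])
    fix k
    have "[int (Suc i) * ?S k = int (Suc i) * (fact i * divided_power w (Suc i) k)] (mod int p ^ k)"
      by (intro cong_mult cong_refl level_of_int_mult)
    also have "int (Suc i) * (fact i * divided_power w (Suc i) k) =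
        fact (Suc i) * divided_power w (Suc i) k"
      by simp
    also have "[fact (Suc i) * divided_power w (Suc i) k = w k ^ Suc i] (mod int p ^ k)"
      by (rule divided_power_level[OF w])
    also have "[w k ^ Suc i = (w [^]\<^bsub>Zp p\<^esub> Suc i) k] (mod int p ^ k)"
      by (rule cong_sym[OF level_pow[OF w(1)]])
    finally show "[int (Suc i) * ?S k = (w [^]\<^bsub>Zp p\<^esub> Suc i) k] (mod int p ^ k)" .
  qed (use w in auto)
  have neg: "\<ominus>\<^bsub>Zp p\<^esub> \<one>\<^bsub>Zp p\<^esub> \<in> carrier (Zp p)" by simp
  show "t i \<in> carrier (Zp p)"
    unfolding t_def div using S neg by simp
  have "[(\<ominus>\<^bsub>Zp p\<^esub> \<one>\<^bsub>Zp p\<^esub>) j = - 1] (mod int p ^ j)"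
    unfolding Zp_minus[OF p_pos one_closed] using level_one[of j]
    by (simp add: cong_minus_minus_iff)
  then have sign: "[((\<ominus>\<^bsub>Zp p\<^esub> \<one>\<^bsub>Zp p\<^esub>) [^]\<^bsub>Zp p\<^esub> i) j = (- 1) ^ i] (mod int p ^ j)"
    using cong_trans[OF level_pow[OF neg] cong_pow] by blast
  have "[t i j = ((\<ominus>\<^bsub>Zp p\<^esub> \<one>\<^bsub>Zp p\<^esub>) [^]\<^bsub>Zp p\<^esub> i) j * ?S j] (mod int p ^ j)"
    unfolding t_def div by (rule level_mult)
  also have "[((\<ominus>\<^bsub>Zp p\<^esub> \<one>\<^bsub>Zp p\<^esub>) [^]\<^bsub>Zp p\<^esub> i) j * ?S j =
      (- 1) ^ i * (fact i * divided_power w (Suc i) j)] (mod int p ^ j)"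
    by (intro cong_mult sign level_of_int_mult)
  finally show "[t i j = (- 1) ^ i * fact i * divided_power w (Suc i) j] (mod int p ^ j)"
    by (simp only: mult.assoc)
qed

lemma
  assumes u: "u \<in> carrier (Zp p)" "u 1 = 1"
  defines "w \<equiv> u \<ominus>\<^bsub>Zp p\<^esub> \<one>\<^bsub>Zp p\<^esub>"
  shows padic_log_closed: "padic_log p u \<in> carrier (Zp p)"
    and padic_log_level: "N \<ge> 2 * j \<Longrightarrow> [padic_log p u j =
      (\<Sum>i<N. (- 1) ^ i * fact i * divided_power w (Suc i) j)] (mod int p ^ j)"
    and minus_one_level_1: "w 1 = 0"
proof -
  have wc: "w \<in> carrier (Zp p)" using u by (simp add: w_def)
  have "[w 1 = u 1 - \<one>\<^bsub>Zp p\<^esub> 1] (mod int p ^ 1)"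
    unfolding w_def by (rule level_minus[OF u(1) one_closed])
  then have "int p ^ 1 dvd w 1"
    using u(2) prime_gt_1_nat[OF prime] by (simp add: Zp_simps cong_0_iff)
  then show w1: "w 1 = 0" using level_eq_0_iff[OF wc order_refl] by blast
  let ?t = "\<lambda>i. (\<ominus>\<^bsub>Zp p\<^esub> \<one>\<^bsub>Zp p\<^esub>) [^]\<^bsub>Zp p\<^esub> i \<otimes>\<^bsub>Zp p\<^esub>
     padic_div_nat p (w [^]\<^bsub>Zp p\<^esub> Suc i) (Suc i)"
  note t = padic_log_term[OF wc w1]
  have vanish: "?t i j = 0" if "i \<ge> 2 * j" for i j
  proof -
    have "[?t i j = 0] (mod int p ^ j)"
      using t(2)[of i j] divided_power_eq_0[OF wc w1, of j "Suc i"] that by simp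
    then show ?thesis
      using level_eq_0_iff[OF t(1) order_refl] by (simp add: cong_0_iff)
  qed
  note sum = padic_suminf[where f = ?t and K = "\<lambda>j. 2 * j", OF t(1)]
  show "padic_log p u \<in> carrier (Zp p)"
    unfolding padic_log_def w_def[symmetric] by (rule sum(1)[OF vanish])
  show "[padic_log p u j =
      (\<Sum>i<N. (- 1) ^ i * fact i * divided_power w (Suc i) j)] (mod int p ^ j)" if "N \<ge> 2 * j"
    using cong_trans[OF sum(2)[OF vanish that] cong_sum[OF t(2)]]
    unfolding padic_log_def w_def[symmetric] .
qed

lemma padic_log_level_1:
  assumes u: "u \<in> carrier (Zp p)" "u 1 = 1"
  shows "padic_log p u 1 = 0"
proof -
  let ?w = "u \<ominus>\<^bsub>Zp p\<^esub> \<one>\<^bsub>Zp p\<^esub>"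
  have w: "?w \<in> carrier (Zp p)" "?w 1 = 0" using u minus_one_level_1[OF u] by auto
  have "[padic_log p u 1 = (\<Sum>i<2. (- 1) ^ i * fact i * divided_power ?w (Suc i) 1)] (mod int p ^ 1)"
    by (rule padic_log_level[OF u]) simp
  also have "(\<Sum>i<2. (- 1) ^ i * fact i * divided_power ?w (Suc i) 1) = 0"
    by (intro sum.neutral ballI) (simp add: divided_power_eq_0[OF w])
  finally show ?thesis
    using level_eq_0_iff[OF padic_log_closed[OF u] order_refl] by (simp add: cong_0_iff)
qed

text \<open>
  With \<open>u = 1 + w\<close>, the binomial theorem gives
  \<open>u\<^sup>q = 1 + q (\<Sum>i. (q - 1 choose i) i! w\<^bsup>i+1\<^esup> / (i + 1)!)\<close>, and modulo \<open>q\<close> the integers \<open>(q - 1 choose i) i!\<close>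
  are the coefficients \<open>(-1)\<^sup>i i!\<close> of the logarithm.
\<close>

lemma padic_log_power_cong:
  assumes u: "u \<in> carrier (Zp p)" "u 1 = 1"
  shows "[u (2 * m) ^ (p ^ m) = 1 + int p ^ m * padic_log p u (2 * m)] (mod int p ^ (2 * m))"
proof -
  let ?Q = "int p ^ (2 * m)" and ?w = "u \<ominus>\<^bsub>Zp p\<^esub> \<one>\<^bsub>Zp p\<^esub>"
  have w: "?w \<in> carrier (Zp p)" "?w 1 = 0" using u minus_one_level_1[OF u] by auto
  define q where "q = p ^ m"
  have q: "q > 0" and Q: "?Q = int q * int q"
    using p_pos by (simp_all add: q_def power_add[symmetric] mult_2)
  define \<tau> where "\<tau> k = divided_power ?w k (2 * m)" for k
  define W where "W = ?w (2 * m)"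
  \<comment> \<open>\<open>N\<close> terms cover both the binomial expansion (up to \<open>q\<close>) and the logarithm (up to \<open>4 m\<close>).\<close>
  define N where "N = 4 * m + q"
  have \<tau>: "[fact k * \<tau> k = W ^ k] (mod ?Q)" for k
    unfolding \<tau>_def W_def by (rule divided_power_level[OF w])
  have "[?w (2 * m) = u (2 * m) - \<one>\<^bsub>Zp p\<^esub> (2 * m)] (mod ?Q)"
    by (rule level_minus[OF u(1) one_closed])
  also have "[u (2 * m) - \<one>\<^bsub>Zp p\<^esub> (2 * m) = u (2 * m) - 1] (mod ?Q)"
    by (intro cong_diff cong_refl level_one)
  finally have "[W + 1 = u (2 * m) - 1 + 1] (mod ?Q)"
    unfolding W_def by (rule cong_add) simp
  then have uW: "[u (2 * m) = W + 1] (mod ?Q)" by (simp add: cong_sym)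
  have "[u (2 * m) ^ q = (W + 1) ^ q] (mod ?Q)" using uW by (rule cong_pow)
  also have "(W + 1) ^ q = (\<Sum>k\<le>q. int (q choose k) * W ^ k)"
    unfolding binomial_ring by simp
  also have "\<dots> = (\<Sum>k<Suc N. int (q choose k) * W ^ k)"
    by (rule sum.mono_neutral_left) (auto simp: N_def)
  also have "\<dots> = 1 + (\<Sum>i<N. int (q choose Suc i) * W ^ Suc i)"
    by (simp add: sum.lessThan_Suc_shift del: sum.lessThan_Suc)
  also have "[1 + (\<Sum>i<N. int (q choose Suc i) * W ^ Suc i) =
      1 + (\<Sum>i<N. int q * ((- 1) ^ i * fact i * \<tau> (Suc i)))] (mod ?Q)"
  proof (intro cong_add cong_sum cong_refl)
    fix i
    have "[int (q choose Suc i) * W ^ Suc i = int (q choose Suc i) * (fact (Suc i) * \<tau> (Suc i))] (mod ?Q)"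
      by (intro cong_mult cong_refl cong_sym[OF \<tau>])
    also have "int (q choose Suc i) * (fact (Suc i) * \<tau> (Suc i)) =
        int (Suc i * (q choose Suc i)) * (fact i * \<tau> (Suc i))"
      by (simp add: algebra_simps)
    also have "Suc i * (q choose Suc i) = q * ((q - 1) choose i)"
      by (rule binomial_absorption)
    also have "int (q * ((q - 1) choose i)) * (fact i * \<tau> (Suc i)) =
        int q * ((fact i * int ((q - 1) choose i)) * \<tau> (Suc i))"
      by simp
    also have "[int q * ((fact i * int ((q - 1) choose i)) * \<tau> (Suc i)) =
        int q * ((- 1) ^ i * fact i * \<tau> (Suc i))] (mod ?Q)"
      unfolding Q by (intro cong_cmult_leftI cong_mult fact_mult_binomial_cong q cong_refl)
    finally show "[int (q choose Suc i) * W ^ Suc i = int q * ((- 1) ^ i * fact i * \<tau> (Suc i))] (mod ?Q)" .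
  qed
  also have "1 + (\<Sum>i<N. int q * ((- 1) ^ i * fact i * \<tau> (Suc i))) =
      1 + int q * (\<Sum>i<N. (- 1) ^ i * fact i * \<tau> (Suc i))"
    by (simp only: sum_distrib_left)
  also have "[1 + int q * (\<Sum>i<N. (- 1) ^ i * fact i * \<tau> (Suc i)) =
      1 + int q * padic_log p u (2 * m)] (mod ?Q)"
    unfolding \<tau>_def
    by (intro cong_add cong_mult cong_refl cong_sym[OF padic_log_level[OF u]]) (simp add: N_def)
  finally show ?thesis by (simp add: q_def)
qed

text \<open>
  The exponential \<open>p\<int>\<^sub>p \<rightarrow> 1 + p\<int>\<^sub>p\<close> and the logarithm are inverse to each other. Raising to the power
  \<open>q = p\<^sup>m\<close> linearizes both modulo \<open>q\<^sup>2\<close>; dividing by \<open>q\<close>, or taking \<open>q\<close>-th roots by lifting the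
  exponent, costs \<open>m\<close> of the \<open>2 m\<close> known digits.
\<close>

lemma padic_exp_eq_iff_log:
  assumes y: "y \<in> carrier (Zp p)" "y 1 = 0" and u: "u \<in> carrier (Zp p)" "u 1 = 1"
  shows "padic_exp p y = u \<longleftrightarrow> y = padic_log p u"
proof
  let ?L = "padic_log p u"
  have halve: "[a = b] (mod int p ^ m)"
    if "int p ^ (2 * m) dvd int p ^ m * (a - b)" for a b :: int and m
    using that p_pos by (simp add: mult_2 power_add cong_iff_dvd_diff)
  have descend: "[x m = z m] (mod int p ^ m)"
    if "x \<in> carrier (Zp p)" "z \<in> carrier (Zp p)" "[x (2 * m) = z (2 * m)] (mod int p ^ m)" for x z m
  proof -
    have "[x m = x (2 * m)] (mod int p ^ m)" "[z (2 * m) = z m] (mod int p ^ m)"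
      using level_cong[OF that(1), of m "2 * m"] level_cong[OF that(2), of m "2 * m"]
      by (simp_all add: cong_sym)
    then show ?thesis using that(3) by (meson cong_trans)
  qed
  note L = padic_log_closed[OF u] and E = padic_exp_closed[OF y]
  {
    assume eq: "padic_exp p y = u"
    show "y = ?L"
    proof (rule padic_eqI[OF y(1) L], rule descend[OF y(1) L], rule halve)
      fix m
      have "[1 + int p ^ m * y (2 * m) = 1 + int p ^ m * ?L (2 * m)] (mod int p ^ (2 * m))"
        using cong_trans[OF cong_sym[OF padic_exp_power_cong[OF y, of m, unfolded eq]]
            padic_log_power_cong[OF u, of m]] .
      then show "int p ^ (2 * m) dvd int p ^ m * (y (2 * m) - ?L (2 * m))"
        by (simp add: cong_iff_dvd_diff right_diff_distrib)
    qed
  next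
    assume eq: "y = ?L"
    show "padic_exp p y = u"
    proof (rule padic_eqI[OF E u(1)], rule descend[OF E u(1)])
      fix m
      let ?e = "padic_exp p y (2 * m)"
      show "[?e = u (2 * m)] (mod int p ^ m)"
      proof (cases "m = 0")
        case False
        have "[?e ^ (p ^ m) = u (2 * m) ^ (p ^ m)] (mod int p ^ (2 * m))"
          using cong_trans[OF padic_exp_power_cong[OF y, of m, unfolded eq]
              cong_sym[OF padic_log_power_cong[OF u, of m]]] unfolding eq .
        then have "int p ^ (2 * m) dvd 1 * (?e ^ (p ^ m) - u (2 * m) ^ (p ^ m))"
          unfolding cong_iff_dvd_diff by simp
        moreover have "[?e = u (2 * m)] (mod int p)"
        proof -
          have "[?e = padic_exp p y 1] (mod int p ^ 1)" "[u (2 * m) = u 1] (mod int p ^ 1)"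
            using False by (intro level_cong E u; simp)+
          then show ?thesis
            unfolding padic_exp_level_1[OF y] u(2) power_one_right by (meson cong_sym cong_trans)
        qed
        moreover have "\<not> int p dvd ?e"
          using level_1_not_dvd[OF E] padic_exp_level_1[OF y] False by simp
        ultimately have "int p ^ (2 * m) dvd 1 * int (p ^ m) * (?e - u (2 * m))"
          using lifting_the_exponent[OF prime odd] by blast
        then show ?thesis by (intro halve) simp
      qed simp
    qed
  }
qed

text \<open>
  \<open>log u = 0\<close> means \<open>u = exp 0\<close>, and \<open>exp 0 = 1\<close> because \<open>log 1 = 0\<close>, which is the linearization of
  \<open>1\<^sup>q = 1\<close>.
\<close>

lemma padic_log_eq_0_iff:
  assumes u: "u \<in> carrier (Zp p)" "u 1 = 1"
  shows "padic_log p u = \<zero>\<^bsub>Zp p\<^esub> \<longleftrightarrow> u = \<one>\<^bsub>Zp p\<^esub>"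
proof -
  have one: "\<one>\<^bsub>Zp p\<^esub> 1 = 1" and zero: "\<zero>\<^bsub>Zp p\<^esub> 1 = 0"
    using prime_gt_1_nat[OF prime] by (simp_all add: Zp_simps)
  note L = padic_log_closed[OF one_closed one]
  have "padic_log p \<one>\<^bsub>Zp p\<^esub> = \<zero>\<^bsub>Zp p\<^esub>"
  proof (rule padic_int_mult_cancel[OF L zero_closed, of 1])
    fix k
    show "[int 1 * padic_log p \<one>\<^bsub>Zp p\<^esub> k = int 1 * \<zero>\<^bsub>Zp p\<^esub> k] (mod int p ^ k)"
    proof -
      have "[\<one>\<^bsub>Zp p\<^esub> (2 * k) ^ (p ^ k) = 1 ^ (p ^ k)] (mod int p ^ (2 * k))"
        by (intro cong_pow level_one)
      then have "[1 + int p ^ k * padic_log p \<one>\<^bsub>Zp p\<^esub> (2 * k) = 1] (mod int p ^ (2 * k))"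
        using cong_trans[OF cong_sym[OF padic_log_power_cong[OF one_closed one, of k]]] by simp
      then have "int p ^ k dvd padic_log p \<one>\<^bsub>Zp p\<^esub> (2 * k)"
        using p_pos by (simp add: cong_iff_dvd_diff mult_2 power_add)
      then show ?thesis
        using level_eq_0_iff[OF L, of k "2 * k"] by (simp add: Zp_simps)
    qed
  qed simp
  then have "padic_exp p \<zero>\<^bsub>Zp p\<^esub> = \<one>\<^bsub>Zp p\<^esub>"
    using padic_exp_eq_iff_log[OF zero_closed zero one_closed one] by simp
  then show ?thesis
    using padic_exp_eq_iff_log[OF zero_closed zero u] by metis
qed

lemma padic_exp_mult_log_eq_iff:
  assumes z: "z \<in> carrier (Zp p)" and u: "u \<in> carrier (Zp p)" "u 1 = 1"
  shows "padic_exp p (z \<otimes>\<^bsub>Zp p\<^esub> padic_log p u) = u \<longleftrightarrow> z = \<one>\<^bsub>Zp p\<^esub> \<or> u = \<one>\<^bsub>Zp p\<^esub>"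
proof -
  let ?L = "padic_log p u"
  note L = padic_log_closed[OF u]
  have zL: "z \<otimes>\<^bsub>Zp p\<^esub> ?L \<in> carrier (Zp p)"
    using z L by simp
  have zL1: "(z \<otimes>\<^bsub>Zp p\<^esub> ?L) 1 = 0"
    using padic_log_level_1[OF u] by (simp add: Zp_simps(2))
  have "padic_exp p (z \<otimes>\<^bsub>Zp p\<^esub> ?L) = u \<longleftrightarrow> z \<otimes>\<^bsub>Zp p\<^esub> ?L = ?L"
    by (rule padic_exp_eq_iff_log[OF zL zL1 u])
  also have "\<dots> \<longleftrightarrow> (z \<ominus>\<^bsub>Zp p\<^esub> \<one>\<^bsub>Zp p\<^esub>) \<otimes>\<^bsub>Zp p\<^esub> ?L = \<zero>\<^bsub>Zp p\<^esub>"
  proof -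
    have "(z \<ominus>\<^bsub>Zp p\<^esub> \<one>\<^bsub>Zp p\<^esub>) \<otimes>\<^bsub>Zp p\<^esub> ?L = z \<otimes>\<^bsub>Zp p\<^esub> ?L \<ominus>\<^bsub>Zp p\<^esub> ?L"
      using z L by (simp add: a_minus_def l_distr l_minus)
    then show ?thesis using zL L by (simp add: r_right_minus_eq)
  qed
  also have "\<dots> \<longleftrightarrow> z \<ominus>\<^bsub>Zp p\<^esub> \<one>\<^bsub>Zp p\<^esub> = \<zero>\<^bsub>Zp p\<^esub> \<or> ?L = \<zero>\<^bsub>Zp p\<^esub>"
    using padic_mult_eq_0[OF minus_closed[OF z one_closed] L] l_null[OF L]
      r_null[OF minus_closed[OF z one_closed]] by metis
  finally show ?thesis
    using z padic_log_eq_0_iff[OF u] by (simp add: r_right_minus_eq)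
qed

end

section \<open>Roots of unity and Teichmueller representatives\<close>

locale padic_root_of_unity = odd_prime +
  fixes n :: nat and \<xi> :: "nat \<Rightarrow> int"
  assumes n: "n > 0" and \<xi>: "\<xi> \<in> carrier (Zp p)" and root: "\<xi> [^]\<^bsub>Zp p\<^esub> n = \<one>\<^bsub>Zp p\<^esub>"
begin

definition d :: nat where "d = padic_ord p \<xi>"

definition g :: nat where "g = nat (\<xi> 1)"

lemma one_level_1: "\<one>\<^bsub>Zp p\<^esub> 1 = 1"
  using prime_gt_1_nat[OF prime] by (simp add: Zp_simps)

lemma pow_level_1:
  assumes "x \<in> carrier (Zp p)"
  shows "[(x [^]\<^bsub>Zp p\<^esub> (m :: nat)) 1 = x 1 ^ m] (mod int p)"
  using level_pow[OF assms, of m 1] by (simp only: power_one_right)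

lemma int_g: "int g = \<xi> 1"
proof -
  have "0 \<le> \<xi> 1" using \<xi> unfolding Zp_simps(1) by blast
  then show ?thesis by (simp add: g_def)
qed

lemma g_pow_n: "[g ^ n = 1] (mod p)"
proof -
  have "[\<xi> 1 ^ n = 1] (mod int p)"
    using cong_sym[OF pow_level_1[OF \<xi>, of n]] unfolding root one_level_1 .
  then show ?thesis
    unfolding int_g[symmetric] using cong_int_iff[of "g ^ n" 1 p] by simp
qed

lemma coprime_g: "coprime p g"
proof -
  have "coprime (g ^ n) p" using cong_imp_coprime[OF cong_sym[OF g_pow_n]] by simp
  then show ?thesis using n by (simp add: coprime_commute)
qed

lemma \<xi>_level_1: "\<xi> 1 \<noteq> 0"
proof
  assume "\<xi> 1 = 0"
  then have "g = 0" by (simp add: g_def)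
  then show False using coprime_g prime_gt_1_nat[OF prime] by simp
qed

lemma d_eq: "d = ord p g"
  by (simp add: d_def padic_ord_def g_def)

lemma d_pos: "d > 0"
  using coprime_g by (simp add: d_eq)

lemma d_dvd_n: "d dvd n"
  using g_pow_n ord_divides by (simp add: d_eq)

lemma d_dvd_p_minus_1: "d dvd p - 1"
  using order_divides_totient[of p g] coprime_g totient_prime[OF prime] by (simp add: d_eq)

lemma p_not_dvd_d: "\<not> p dvd d"
proof
  assume "p dvd d"
  then have "p dvd p - 1" using d_dvd_p_minus_1 by (rule dvd_trans)
  then show False using prime_gt_1_nat[OF prime] by (auto dest: dvd_imp_le)
qed

text \<open>
  Powers of \<open>\<xi>\<close> are again \<open>n\<close>-th roots of unity, hence determined by their residues modulo \<open>p\<close>, so the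
  order of \<open>\<xi>\<close> in \<open>\<int>\<^sub>p\<close> equals its order modulo \<open>p\<close>.
\<close>

lemma \<xi>_pow_eq_iff: "\<xi> [^]\<^bsub>Zp p\<^esub> a = \<xi> [^]\<^bsub>Zp p\<^esub> b \<longleftrightarrow> [a = b] (mod d)" for a b :: nat
proof -
  have closed: "\<xi> [^]\<^bsub>Zp p\<^esub> a \<in> carrier (Zp p)" for a :: nat using \<xi> by simp
  have "[a = b] (mod d) \<longleftrightarrow> [g ^ a = g ^ b] (mod p)"
    unfolding d_eq using coprime_g by (simp add: order_divides_expdiff)
  also have "\<dots> \<longleftrightarrow> [\<xi> 1 ^ a = \<xi> 1 ^ b] (mod int p)"
    unfolding int_g[symmetric] using cong_int_iff[of "g ^ a" "g ^ b" p] by simp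
  also have "\<dots> \<longleftrightarrow> [(\<xi> [^]\<^bsub>Zp p\<^esub> a) 1 = (\<xi> [^]\<^bsub>Zp p\<^esub> b) 1] (mod int p ^ 1)"
    unfolding power_one_right
    using pow_level_1[OF \<xi>, of a] pow_level_1[OF \<xi>, of b] by (meson cong_sym cong_trans)
  also have "\<dots> \<longleftrightarrow> (\<xi> [^]\<^bsub>Zp p\<^esub> a) 1 = (\<xi> [^]\<^bsub>Zp p\<^esub> b) 1"
    by (rule level_eq_iff[OF closed closed, symmetric])
  finally have residues: "[a = b] (mod d) \<longleftrightarrow> (\<xi> [^]\<^bsub>Zp p\<^esub> a) 1 = (\<xi> [^]\<^bsub>Zp p\<^esub> b) 1" .
  have "\<xi> [^]\<^bsub>Zp p\<^esub> a = \<xi> [^]\<^bsub>Zp p\<^esub> b" if eq: "(\<xi> [^]\<^bsub>Zp p\<^esub> a) 1 = (\<xi> [^]\<^bsub>Zp p\<^esub> b) 1"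
  proof (rule padic_pow_inj[OF closed closed n eq])
    have "\<not> int p dvd \<xi> 1 ^ a"
      using prime_not_dvd_power[OF prime level_1_not_dvd[OF \<xi> \<xi>_level_1]] by simp
    then have "\<not> int p dvd (\<xi> [^]\<^bsub>Zp p\<^esub> a) 1"
      using cong_dvd_iff[OF pow_level_1[OF \<xi>, of a]] by blast
    then show "(\<xi> [^]\<^bsub>Zp p\<^esub> a) 1 \<noteq> 0" by (metis dvd_0_right)
    have "(\<xi> [^]\<^bsub>Zp p\<^esub> a) [^]\<^bsub>Zp p\<^esub> n = \<one>\<^bsub>Zp p\<^esub>" for a :: nat
      using \<xi> root nat_pow_pow[OF \<xi>, of a n] nat_pow_pow[OF \<xi>, of n a]
      by (simp add: mult.commute)
    then show "(\<xi> [^]\<^bsub>Zp p\<^esub> a) [^]\<^bsub>Zp p\<^esub> n = (\<xi> [^]\<^bsub>Zp p\<^esub> b) [^]\<^bsub>Zp p\<^esub> n" by simp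
  qed
  with residues show ?thesis by metis
qed

lemma \<xi>_pow_d: "\<xi> [^]\<^bsub>Zp p\<^esub> d = \<one>\<^bsub>Zp p\<^esub>"
  using \<xi>_pow_eq_iff[of d 0] by (simp add: cong_def)

lemma \<xi>_eqI:
  fixes m :: nat
  assumes "x \<in> carrier (Zp p)" and "x 1 = \<xi> 1" and "x [^]\<^bsub>Zp p\<^esub> m = \<xi> [^]\<^bsub>Zp p\<^esub> m" and "m > 0"
  shows "x = \<xi>"
  using padic_pow_inj[OF assms(1) \<xi> assms(4,2) _ assms(3)] \<xi>_level_1 assms(2) by simp

lemma teichmuller_eq:
  assumes x: "x \<in> carrier (Zp p)" "x 1 = \<xi> 1"
  shows "teichmuller p x = \<xi>"
  unfolding teichmuller_def
proof (rule the_equality)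
  have p1: "\<xi> [^]\<^bsub>Zp p\<^esub> (p - 1) = \<one>\<^bsub>Zp p\<^esub>"
    using \<xi>_pow_eq_iff[of "p - 1" 0] d_dvd_p_minus_1 by (simp add: cong_0_iff)
  show "\<xi> \<in> carrier (Zp p) \<and> \<xi> [^]\<^bsub>Zp p\<^esub> (p - 1) = \<one>\<^bsub>Zp p\<^esub> \<and> padic_cong p 1 \<xi> x"
    using \<xi> p1 x padic_cong_iff[OF p_pos \<xi> x(1), of 1] by simp
  show "t = \<xi>"
    if "t \<in> carrier (Zp p) \<and> t [^]\<^bsub>Zp p\<^esub> (p - 1) = \<one>\<^bsub>Zp p\<^esub> \<and> padic_cong p 1 t x" for t
    using that padic_cong_iff[OF p_pos _ x(1), of t 1] x(2) p1 prime_gt_1_nat[OF prime]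
    by (intro \<xi>_eqI[of t "p - 1"]) auto
qed

lemma \<xi>_Unit: "\<xi> \<in> Units (Zp p)"
proof -
  obtain m where m: "n = Suc m" using n by (cases n) auto
  have "\<xi> [^]\<^bsub>Zp p\<^esub> m \<otimes>\<^bsub>Zp p\<^esub> \<xi> = \<one>\<^bsub>Zp p\<^esub>"
    using root unfolding m nat_pow_Suc .
  moreover from this have "\<xi> \<otimes>\<^bsub>Zp p\<^esub> \<xi> [^]\<^bsub>Zp p\<^esub> m = \<one>\<^bsub>Zp p\<^esub>"
    using m_comm[OF \<xi> nat_pow_closed[OF \<xi>], of m] by simp
  ultimately show ?thesis
    unfolding Units_def using \<xi> nat_pow_closed[OF \<xi>, of m] by blast
qed

lemma padic_angle_eq:
  assumes x: "x \<in> carrier (Zp p)" "x 1 = \<xi> 1"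
  shows padic_angle_closed: "padic_angle p x \<in> carrier (Zp p)"
    and mult_padic_angle: "\<xi> \<otimes>\<^bsub>Zp p\<^esub> padic_angle p x = x"
    and padic_angle_level_1: "padic_angle p x 1 = 1"
proof -
  let ?u = "padic_angle p x"
  have u_def: "?u = x \<otimes>\<^bsub>Zp p\<^esub> inv\<^bsub>Zp p\<^esub> \<xi>"
    unfolding padic_angle_def teichmuller_eq[OF x] ..
  have inv: "inv\<^bsub>Zp p\<^esub> \<xi> \<in> carrier (Zp p)" using \<xi>_Unit by simp
  show u: "?u \<in> carrier (Zp p)" unfolding u_def using x inv by simp
  have "\<xi> \<otimes>\<^bsub>Zp p\<^esub> (x \<otimes>\<^bsub>Zp p\<^esub> inv\<^bsub>Zp p\<^esub> \<xi>) = x \<otimes>\<^bsub>Zp p\<^esub> (\<xi> \<otimes>\<^bsub>Zp p\<^esub> inv\<^bsub>Zp p\<^esub> \<xi>)"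
    by (rule m_lcomm[OF \<xi> x(1) inv])
  then show eq: "\<xi> \<otimes>\<^bsub>Zp p\<^esub> ?u = x"
    unfolding u_def using x \<xi>_Unit by simp
  have "[\<xi> 1 * ?u 1 = \<xi> 1 * \<one>\<^bsub>Zp p\<^esub> 1] (mod int p)"
    using cong_sym[OF level_mult[of \<xi> ?u 1]] unfolding eq x(2) one_level_1 by simp
  then have "[?u 1 = \<one>\<^bsub>Zp p\<^esub> 1] (mod int p ^ 1)"
    using coprime_g unfolding int_g[symmetric]
    by (simp add: cong_mult_lcancel coprime_commute)
  then have "?u 1 = \<one>\<^bsub>Zp p\<^esub> 1"
    using level_eq_iff[OF u one_closed, of 1] by blast
  then show "?u 1 = 1" unfolding one_level_1 .
qed

section \<open>Solutions in the p-adic integers\<close>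

text \<open>
  The factor \<open>E = \<langle>x\<rangle>\<^bsup>x^n\<^esup>\<close> is \<open>1\<close> modulo \<open>p\<close>, so modulo \<open>p\<close> the equation only constrains the power of \<open>\<xi>\<close>,
  which gives \<open>x\<^sub>0\<^sup>n \<equiv> 1\<close> modulo \<open>d\<close>. Then \<open>\<xi>\<close> cancels, and \<open>E = \<langle>x\<rangle>\<close> holds for \<open>x = \<xi>\<close> only.
\<close>

lemma mem_G_inf_iff:
  "(x, x0) \<in> G_inf p n \<xi> \<longleftrightarrow> x = \<xi> \<and> x0 \<in> {1..p - 1} \<and> [x0 ^ n = 1] (mod d)"
proof (cases "x \<in> carrier (Zp p) \<and> x 1 = \<xi> 1")
  case False
  then show ?thesis
    using \<xi> padic_cong_iff[OF p_pos _ \<xi>, of x 1] by (auto simp: G_inf_def)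
next
  case True
  then have x: "x \<in> carrier (Zp p)" "x 1 = \<xi> 1" by auto
  define z where "z = x [^]\<^bsub>Zp p\<^esub> n"
  define u where "u = padic_angle p x"
  define E where "E = angle_pow p x z"
  have z: "z \<in> carrier (Zp p)" using x by (simp add: z_def)
  note u = padic_angle_eq[OF x, folded u_def]
  have E_def': "E = padic_exp p (z \<otimes>\<^bsub>Zp p\<^esub> padic_log p u)"
    by (simp add: E_def angle_pow_def u_def)
  have L: "padic_log p u \<in> carrier (Zp p)" "padic_log p u 1 = 0"
    using padic_log_closed[OF u(1,3)] padic_log_level_1[OF u(1,3)] by auto
  have zL: "z \<otimes>\<^bsub>Zp p\<^esub> padic_log p u \<in> carrier (Zp p)" using z L by simp
  have zL1: "(z \<otimes>\<^bsub>Zp p\<^esub> padic_log p u) 1 = 0" using L(2) by (simp add: Zp_simps(2))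
  have E: "E \<in> carrier (Zp p)" "E 1 = 1"
    unfolding E_def' using padic_exp_closed[OF zL zL1] padic_exp_level_1[OF zL zL1] by auto
  have E_eq: "E = u \<longleftrightarrow> x = \<xi>"
  proof -
    have "E = u \<longleftrightarrow> z = \<one>\<^bsub>Zp p\<^esub> \<or> u = \<one>\<^bsub>Zp p\<^esub>"
      unfolding E_def' by (rule padic_exp_mult_log_eq_iff[OF z u(1,3)])
    also have "z = \<one>\<^bsub>Zp p\<^esub> \<longleftrightarrow> x = \<xi>"
      using \<xi>_eqI[OF x, of n] n root by (auto simp: z_def)
    also have "u = \<one>\<^bsub>Zp p\<^esub> \<longleftrightarrow> x = \<xi>"
      using u \<xi> Units_l_cancel[OF \<xi>_Unit u(1) one_closed] by auto
    finally show ?thesis by simp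
  qed
  have "\<xi> [^]\<^bsub>Zp p\<^esub> (x0 ^ n) \<otimes>\<^bsub>Zp p\<^esub> E = x \<longleftrightarrow> x = \<xi> \<and> [x0 ^ n = 1] (mod d)"
  proof
    assume eq: "\<xi> [^]\<^bsub>Zp p\<^esub> (x0 ^ n) \<otimes>\<^bsub>Zp p\<^esub> E = x"
    have pow: "\<xi> [^]\<^bsub>Zp p\<^esub> (x0 ^ n) \<in> carrier (Zp p)" using \<xi> by simp
    have "(\<xi> [^]\<^bsub>Zp p\<^esub> (x0 ^ n)) 1 = \<xi> 1"
    proof -
      have "(\<xi> [^]\<^bsub>Zp p\<^esub> (x0 ^ n) \<otimes>\<^bsub>Zp p\<^esub> E) 1 = (\<xi> [^]\<^bsub>Zp p\<^esub> (x0 ^ n)) 1 mod int p ^ 1"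
        unfolding Zp_simps(2) E(2) by simp
      then show ?thesis unfolding eq x(2) using level_mod[OF pow, of 1] by simp
    qed
    then have "[\<xi> 1 ^ (x0 ^ n) = \<xi> 1 ^ 1] (mod int p)"
      using pow_level_1[OF \<xi>, of "x0 ^ n"] by (simp add: cong_sym)
    then have "[g ^ (x0 ^ n) = g ^ 1] (mod p)"
      unfolding int_g[symmetric] using cong_int_iff[of "g ^ (x0 ^ n)" "g ^ 1" p] by simp
    then have cong: "[x0 ^ n = 1] (mod d)"
      unfolding d_eq using coprime_g by (simp only: order_divides_expdiff)
    then have "\<xi> [^]\<^bsub>Zp p\<^esub> (x0 ^ n) = \<xi>"
      using \<xi>_pow_eq_iff[of "x0 ^ n" 1] \<xi> by simp
    then have "\<xi> \<otimes>\<^bsub>Zp p\<^esub> E = \<xi> \<otimes>\<^bsub>Zp p\<^esub> u" using eq u(2) by simp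
    then have "E = u" using Units_l_cancel[OF \<xi>_Unit E(1) u(1)] by simp
    with cong E_eq show "x = \<xi> \<and> [x0 ^ n = 1] (mod d)" by simp
  next
    assume "x = \<xi> \<and> [x0 ^ n = 1] (mod d)"
    then show "\<xi> [^]\<^bsub>Zp p\<^esub> (x0 ^ n) \<otimes>\<^bsub>Zp p\<^esub> E = x"
      using E_eq u(2) \<xi>_pow_eq_iff[of "x0 ^ n" 1] \<xi> by simp
  qed
  moreover have "\<not> padic_of_int p (int p) divides\<^bsub>Zp p\<^esub> x"
    using x(2) \<xi>_level_1 by (auto simp: factor_def Zp_simps(2) padic_of_int_eq[OF p_pos])
  moreover have "padic_cong p 1 x \<xi>"
    using padic_cong_iff[OF p_pos x(1) \<xi>] x(2) by simp
  ultimately show ?thesis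
    unfolding G_inf_def using x teichmuller_eq[OF x] by (auto simp: E_def z_def)
qed

lemma cong_pow_add_modulus: "[(x + d) ^ n = 1] (mod d) \<longleftrightarrow> [x ^ n = 1] (mod d)"
  by (simp add: cong_def power_mod[symmetric, of "x + d"] power_mod[symmetric, of x])

lemma card_G_inf: "card (G_inf p n \<xi>) = (p - 1) div d * num_unity_roots n d"
proof -
  have "G_inf p n \<xi> = {\<xi>} \<times> {x0 \<in> {1..p - 1}. [x0 ^ n = 1] (mod d)}"
    using mem_G_inf_iff by auto
  then have "card (G_inf p n \<xi>) = card {x0 \<in> {1..d * ((p - 1) div d)}. [x0 ^ n = 1] (mod d)}"
    using d_dvd_p_minus_1 by (simp add: card_cartesian_product)
  also have "\<dots> = (p - 1) div d * num_unity_roots n d"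
    unfolding num_unity_roots_eq 
    by (rule card_periodic[where P = "\<lambda>x. [x ^ n = 1] (mod d)"]) (rule cong_pow_add_modulus)
  finally show ?thesis .
qed

section \<open>Solutions modulo prime powers\<close>

text \<open>
  The number of \<open>p\<close>-adic digits that a solution modulo \<open>p\<^sup>e\<close> must share with \<open>\<xi>\<close>: \<open>(e - v\<^sub>p(n)) / 2\<close> rounded up,
  but at least the one digit imposed by \<open>x \<equiv> \<xi>\<close> modulo \<open>p\<close>. Truncated subtraction covers \<open>e \<le> v\<^sub>p(n)\<close>.
\<close>

definition closeness where "closeness e = max 1 ((e - multiplicity p n + 1) div 2)"

lemma closeness_le: "e \<ge> 1 \<Longrightarrow> closeness e \<le> e"
  by (auto simp: closeness_def)

lemma dvd_iff_closeness:
  fixes s :: int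
  assumes "int p dvd s"
  shows "int p ^ e dvd int n * s\<^sup>2 \<longleftrightarrow> int p ^ closeness e dvd s"
proof -
  define k where "k = (e - multiplicity p n + 1) div 2"
  have "int p ^ e dvd int n * s\<^sup>2 \<longleftrightarrow> int p ^ k dvd s"
    unfolding prime_power_dvd_mult_nat_iff[OF prime n] prime_power_dvd_square_iff[OF prime] k_def ..
  also have "\<dots> \<longleftrightarrow> int p ^ closeness e dvd s"
  proof -
    have "closeness e = max 1 k" by (simp add: closeness_def k_def)
    then show ?thesis using assms by (cases k) simp_all
  qed
  finally show ?thesis .
qed

text \<open>
  Lifting the exponent is used three times: from \<open>t\<^sup>l - 1\<close> to \<open>l (t - 1)\<close>, from \<open>t\<^sup>m - 1\<close> to \<open>m (t - 1)\<close>,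
  where \<open>t = x\<^sup>d\<close>, \<open>x\<^sup>n - 1 = d l\<close> and \<open>n = d m\<close>, and from \<open>x\<^sup>d - \<xi>\<^sup>d\<close> to \<open>d (x - \<xi>)\<close>. The unit \<open>d\<close> is
  inserted or removed at each step.
\<close>

lemma self_power_cong_iff:
  assumes e: "e \<ge> 1" and x: "x > 0" and xg: "[int x = \<xi> 1] (mod int p)"
  shows "[x ^ (x ^ n) = x] (mod p ^ e) \<longleftrightarrow>
    [int x = \<xi> (closeness e)] (mod int p ^ closeness e) \<and> [x ^ n = 1] (mod d)"
proof -
  define N where "N = x ^ n - 1"
  define T where "T = int x ^ d"
  have xg': "[x = g] (mod p)" using xg unfolding int_g[symmetric] cong_int_iff .
  have nd: "\<not> int p dvd int x"
    using cong_dvd_iff[OF xg] level_1_not_dvd[OF \<xi> \<xi>_level_1, of 1] by simp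
  have cop: "coprime x (p ^ e)"
    using cong_imp_coprime[OF cong_sym[OF xg']] coprime_g by (simp add: coprime_commute)
  have xn: "x ^ n = Suc N" using x by (simp add: N_def)
  have "[x ^ (x ^ n) = x] (mod p ^ e) \<longleftrightarrow> [x * x ^ N = x * 1] (mod p ^ e)"
    by (simp add: xn)
  also have "\<dots> \<longleftrightarrow> [x ^ N = 1] (mod p ^ e)"
    by (rule cong_mult_lcancel_nat[OF cop])
  finally have unit_form: "[x ^ (x ^ n) = x] (mod p ^ e) \<longleftrightarrow> [x ^ N = 1] (mod p ^ e)" .
  have ord_x: "ord p x = d" unfolding d_eq by (rule ord_cong[OF xg'])
  have d_dvd_N: "d dvd N \<longleftrightarrow> [x ^ n = 1] (mod d)"
    using cong_add_rcancel_0_nat[of N 1 d] by (simp add: xn cong_0_iff)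
  show ?thesis
  proof (cases "d dvd N")
    case False
    have "\<not> [x ^ N = 1] (mod p ^ e)"
    proof
      assume "[x ^ N = 1] (mod p ^ e)"
      then have "[x ^ N = 1] (mod p)"
        by (rule cong_dvd_modulus_nat) (use e in simp)
      then show False using False unfolding ord_divides ord_x by simp
    qed
    with False show ?thesis by (simp add: unit_form d_dvd_N)
  next
    case True
    then obtain l where l: "N = d * l" by blast
    obtain m where m: "n = d * m" using d_dvd_n by blast
    have "[x ^ d = 1] (mod p)" unfolding ord_divides ord_x by simp
    then have T1: "[T = 1] (mod int p)"
      unfolding T_def using cong_int_iff[of "x ^ d" 1 p] by simp
    have ndT: "\<not> int p dvd T" unfolding T_def by (rule prime_not_dvd_power[OF prime nd])
    note lte = lifting_the_exponent[OF prime odd T1 ndT, unfolded power_one]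
    have unit_d: "int p ^ k dvd int d * y \<longleftrightarrow> int p ^ k dvd y" for k y
      using prime_power_dvd_unit_mult_iff[OF prime, of "int d"] p_not_dvd_d by simp
    have "[x ^ N = 1] (mod p ^ e) \<longleftrightarrow> int p ^ e dvd 1 * (T ^ l - 1)"
      using cong_int_iff[of "x ^ N" 1 "p ^ e"]
      by (simp add: T_def l power_mult cong_iff_dvd_diff)
    also have "\<dots> \<longleftrightarrow> int p ^ e dvd int d * (1 * int l * (T - 1))"
      unfolding lte unit_d ..
    also have "int d * (1 * int l * (T - 1)) = (T - 1) * (T ^ m - 1)"
    proof -
      have "int d * int l = int (x ^ n) - 1" unfolding xn l by simp
      also have "\<dots> = T ^ m - 1" by (simp add: T_def m power_mult)
      finally show ?thesis by (simp add: mult_ac)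
    qed
    also have "int p ^ e dvd (T - 1) * (T ^ m - 1) \<longleftrightarrow>
        int p ^ e dvd int d * ((T - 1) * int m * (T - 1))"
      unfolding lte unit_d ..
    also have "int d * ((T - 1) * int m * (T - 1)) = int n * (T - 1)\<^sup>2"
      by (simp add: m power2_eq_square mult_ac)
    also have "int p ^ e dvd int n * (T - 1)\<^sup>2 \<longleftrightarrow> int p ^ closeness e dvd T - 1"
      using T1 by (intro dvd_iff_closeness) (simp add: cong_iff_dvd_diff)
    also have "\<dots> \<longleftrightarrow> int p ^ closeness e dvd int x ^ d - \<xi> (closeness e) ^ d"
    proof -
      have "[\<xi> (closeness e) ^ d = 1] (mod int p ^ closeness e)"
        using cong_trans[OF cong_sym[OF level_pow[OF \<xi>, of d "closeness e"]]] level_one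
        unfolding \<xi>_pow_d by blast
      then have "[T - \<xi> (closeness e) ^ d = T - 1] (mod int p ^ closeness e)"
        by (intro cong_diff cong_refl)
      from cong_dvd_iff[OF this] show ?thesis unfolding T_def by simp
    qed
    also have "\<dots> \<longleftrightarrow> int p ^ closeness e dvd int d * (int x - \<xi> (closeness e))"
    proof -
      have "[\<xi> (closeness e) = \<xi> 1] (mod int p ^ 1)"
        by (rule level_cong[OF \<xi>]) (simp add: closeness_def)
      then have "[int x = \<xi> (closeness e)] (mod int p)"
        using cong_trans[OF xg cong_sym] by simp
      from lifting_the_exponent[OF prime odd this nd, of "closeness e" 1 d]
      show ?thesis by simp
    qed
    also have "\<dots> \<longleftrightarrow> [int x = \<xi> (closeness e)] (mod int p ^ closeness e)"
      unfolding unit_d cong_iff_dvd_diff ..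
    finally show ?thesis using True by (simp add: unit_form d_dvd_N)
  qed
qed

lemma G_fin_eq:
  assumes e: "e \<ge> 1"
  shows "G_fin p n \<xi> e = {x \<in> {1..p ^ e * (p - 1)}.
    [x = nat (\<xi> (closeness e))] (mod p ^ closeness e) \<and> [x ^ n = 1] (mod d)}"
proof -
  have l: "[\<xi> (closeness e) = \<xi> 1] (mod int p)"
    using level_cong[OF \<xi>, of 1 "closeness e"] by (simp add: closeness_def)
  have nn: "0 \<le> \<xi> (closeness e)" using \<xi> unfolding Zp_simps(1) by blast
  have nat: "[x = nat (\<xi> (closeness e))] (mod p ^ closeness e) \<longleftrightarrow>
      [int x = \<xi> (closeness e)] (mod int p ^ closeness e)" for x
    using cong_int_iff[of x "nat (\<xi> (closeness e))" "p ^ closeness e"] nn by simp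
  have residue: "padic_cong p 1 (padic_of_int p (int x)) \<xi> \<longleftrightarrow> [int x = \<xi> 1] (mod int p)" for x
    using padic_cong_iff[OF p_pos padic_of_int_closed \<xi>, where m = 1] level_mod[OF \<xi>, of 1]
    by (simp add: padic_of_int_eq[OF p_pos] cong_def)
  have imp: "[int x = \<xi> 1] (mod int p)" if "[int x = \<xi> (closeness e)] (mod int p ^ closeness e)" for x
  proof -
    have "closeness e > 0" by (simp add: closeness_def)
    then have "int p dvd int p ^ closeness e" by simp
    then show ?thesis using cong_trans[OF cong_dvd_modulus[OF that] l] by blast
  qed
  have not_dvd: "\<not> p dvd x" if "[int x = \<xi> 1] (mod int p)" for x
    using cong_dvd_iff[OF that] level_1_not_dvd[OF \<xi> \<xi>_level_1, of 1] by simp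
  show ?thesis
    unfolding G_fin_def residue nat
    using self_power_cong_iff[OF e] imp not_dvd by auto
qed

text \<open>
  With \<open>k = closeness e\<close>, the interval consists of \<open>p\<^bsup>e-k\<^esup> (p - 1) / d\<close> blocks of length \<open>p\<^sup>k d\<close>. In each
  block the Chinese remainder theorem leaves the free choice of an \<open>n\<close>-th root of unity modulo \<open>d\<close>.
\<close>

lemma card_G_fin:
  assumes e: "e \<ge> 1"
  shows "card (G_fin p n \<xi> e) = p ^ (e - closeness e) * ((p - 1) div d) * num_unity_roots n d"
proof -
  let ?k = "closeness e" and ?a = "nat (\<xi> (closeness e))"
  let ?P = "\<lambda>x. [x = ?a] (mod p ^ ?k) \<and> [x ^ n = 1] (mod d)"
  have "p ^ e * (p - 1) = p ^ ?k * d * (p ^ (e - ?k) * ((p - 1) div d))"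
  proof -
    have "p ^ e = p ^ ?k * p ^ (e - ?k)" using closeness_le[OF e] by (simp flip: power_add)
    moreover have "p - 1 = d * ((p - 1) div d)" using d_dvd_p_minus_1 by simp
    ultimately show ?thesis by (metis mult.assoc mult.commute)
  qed
  then have "card (G_fin p n \<xi> e) =
      card {x \<in> {1..p ^ ?k * d * (p ^ (e - ?k) * ((p - 1) div d))}. ?P x}"
    unfolding G_fin_eq[OF e] by simp
  also have "\<dots> = p ^ (e - ?k) * ((p - 1) div d) * card {x \<in> {..<p ^ ?k * d}. ?P x}"
  proof (rule card_periodic)
    fix x
    have "[x + p ^ ?k * d = x] (mod p ^ ?k)" "[x + p ^ ?k * d = x] (mod d)"
      by (simp_all add: cong_def)
    then show "?P (x + p ^ ?k * d) = ?P x"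
      by (meson cong_pow cong_sym cong_trans)
  qed
  also have "card {x \<in> {..<p ^ ?k * d}. ?P x} = num_unity_roots n d"
    unfolding num_unity_roots_eq
  proof (rule card_chinese_remainder)
    show "coprime (p ^ ?k) d"
      using prime p_not_dvd_d by (simp add: prime_imp_coprime)
    show "[(x mod d) ^ n = 1] (mod d) = [x ^ n = 1] (mod d)" for x
      by (simp add: cong_def power_mod)
  qed (use p_pos d_pos in auto)
  finally show ?thesis .
qed

lemma diff_closeness:
  assumes "e \<ge> 1"
  shows "e - closeness e = (if e \<le> multiplicity p n then e - 1 else (e + multiplicity p n) div 2)"
  using assms unfolding closeness_def by (auto simp: max_def)

end

section \<open>The two counts\<close>

theorem theorem8:
  fixes p n :: nat and \<xi> :: "nat \<Rightarrow> int"
  assumes "prime p" and "p \<noteq> 2" and "n \<ge> 1"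
    and "\<xi> \<in> carrier (Zp p)" and "\<xi> [^]\<^bsub>Zp p\<^esub> n = \<one>\<^bsub>Zp p\<^esub>"
  shows "(\<forall>e\<ge>1. real (card (G_fin p n \<xi> e)) =
            real (p - 1) / real (padic_ord p \<xi>) * real (num_unity_roots n (padic_ord p \<xi>)) *
            (if e \<le> multiplicity p n then real p ^ (e - 1)
             else real p ^ ((e + multiplicity p n) div 2))) \<and>
         real (card (G_inf p n \<xi>)) =
            real (p - 1) / real (padic_ord p \<xi>) * real (num_unity_roots n (padic_ord p \<xi>))"
proof -
  interpret padic_root_of_unity p n \<xi>
    using assms by unfold_locales auto
  have quotient: "real (p - 1) / real d = real ((p - 1) div d)"
    using d_dvd_p_minus_1 by (rule real_of_nat_div[symmetric])
  show ?thesis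
    unfolding d_def[symmetric] quotient
    by (auto simp: card_G_fin card_G_inf diff_closeness)
qed

end
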